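(* Let $n\ge4$ and let $\bar{\mathcal F}$ be the modelled quiver associated with a seed $\mathcal G=(Q,\{u_1,\dots,u_n\})$ of type $\mathbb D_n$ whose fork arrows both enter or both leave the joint, embedded in $\mathbb Z^2$ as part of the frieze $\Upsilon$ of type $\mathbb A_{2n-1}$ associated with $\Lambda'$. For a point $(u,v)$ of $\bar{\mathcal F}$ not lying on the boundary $F$ or ${}^tF$, let $b_0x_1b_1x_2\cdots b_mx_{m+1}b_{m+1}$ (with $m\ge1$, $x_i\in\{x,y\}$, $b_i\in\mathbb Q(u_1,\dots,u_n)$) be the word associated with $(u,v)$. Then the value of $\bar{\mathcal F}$ at each of its points $(u,v)$ is $\mathbf T(u,v)$, where $\mathbf T$ is given as follows. (a) If $(u,v)$ lies on the boundary $F$ or ${}^tF$, then $\mathbf T(u,v)$ is the value of the frieze $\Upsilon$ at this point. (b) If the two projections of $(u,v)$ both lie on $F$, or both lie on ${}^tF$, then $$\mathbf T(u,v)=\frac1{b_1b_2\cdots b_m}\,(1,b_0)\prod_{i=2}^{m}M(b_{i-1},x_i,b_i)\begin{pmatrix}1\\ b_{m+1}\end{pmatrix}.$$ (c) If the horizontal projection of $(u,v)$ lies on $F$ and its vertical projection lies on ${}^tF$, then $$\mathbf T(u,v)=\frac1{b_1b_2\cdots b_m}\,(1,b_0)\prod_{i=2}^{m}M(b_{i-1},x_i,b_i)\begin{pmatrix}b_{m+1}\\ 1\end{pmatrix}.$$ Here $$M(a,x,b)=\begin{pmatrix}a&1\\0&b\end{pmatrix},\qquad M(a,y,b)=\begin{pmatrix}b&0\\1&a\end{pmatrix},$$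 the matrix products are taken in increasing order of $i$ from left to right, and an empty product ($m=1$) is the identity matrix.
   Context: **Translation quivers and friezes.** For a finite acyclic quiver $\Theta$, the translation quiver $\mathbb Z\Theta$ has vertices $(k,i)$, $k\in\mathbb Z$, $i\in\Theta_0$, and, for each $k$ and each arrow $i\to j$ of $\Theta$, arrows $(k,i)\to(k,j)$ and $(k,j)\to(k+1,i)$. Given initial values $\mathfrak a(0,i)$ in a field, the associated frieze is $\mathbb Z\Theta$ with values $\mathfrak a(k,i)$ determined by $\mathfrak a(k,i)\mathfrak a(k+1,i)=1+\prod_{(k,i)\to(m,j)}\mathfrak a(m,j)$, the product being over arrows of $\mathbb Z\Theta$ starting at $(k,i)$. All values lie in $\mathbb Q(u_1,\dots,u_n)$, with $u_1,\dots,u_n$ independent variables. **Type $\mathbb D_n$ and the modelled quiver.** $Q$ has vertices $1,\dots,n$ and edges $1-3$, $2-3$, $3-4,\dots,(n-1)-n$, each given an orientation; $3$ is the joint and the fork arrows are those on the edges $1-3$ and $2-3$. Take the frieze of $Q$ with $\mathfrak a(0,i)=u_i$. The modelled quiver $\bar{\mathcal F}$ has vertices $(k,i)$, $0\le k\le n$, $i\in\{1,3,4,\dots,n\}$; the value at $(k,1)$ is $\mathfrak a(k,1)\mathfrak a(k,2)$, and the value at $(k,i)$, $i\ge3$, is $\mathfrak a(k,i)$ (its arrows come from those of $\mathbb ZQ$ by gluing, for each $k$, vertex $(k,2)$ to vertex $(k,1)$). **The boundary $\Lambda'$ and the frieze $\Upsilon$.** Let $\bar\omega$ be the full sub-quiver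 of $Q$ on all vertices except $2$, drawn left to right in the order $1,3,4,\dots,n$, and ${}^t\bar\omega$ the same quiver redrawn in the order $n,\dots,4,3,1$. Let $Q'$ be the quiver ${}^t\bar\omega\to0\to\bar\omega$ of type $\mathbb A_{2n-1}$, with vertices numbered $1,\dots,2n-1$ from left to right and labelled respectively by $$u_n,u_{n-1},\dots,u_3,\;u_1u_2,\;1,\;u_1u_2,\;u_3,\dots,u_{n-1},u_n$$ (the middle vertex $0$, which is the $n$th, has label $u_0=1$). $\Upsilon$ is the frieze of $Q'$ with these labels as initial values at $k=0$. Replacing an arrow pointing right between consecutive vertices by the letter $x$ and an arrow pointing left by $y$, one gets the sequence (boundary) $\Lambda'=u_n\,x_1\,u_{n-1}\,x_2\cdots u_3\,x_{n-2}\,u_1u_2\,x_{n-1}\,1\,x_n\,u_1u_2\,x_{n+1}\,u_3\cdots u_{n-1}\,x_{2n-2}\,u_n$ (so $x_{n-1}=x_n=x$). **Embedding in the plane.** The position boundary is $F=y\Lambda'x$, with both added end points labelled $1$. It is drawn as a lattice path $p_0,p_1,\dots,p_{2n}$ with $p_0=(0,0)$, a letter $x$ being a step $(u,v)\to(u+1,v)$ and a letter $y$ a step $(u,v)\to(u,v+1)$; $p_j$ ($1\le j\le 2n-1$) carries the $j$th label of $\Lambda'$. One has $p_{2n}=(n+1,n-1)$. The vertex $(k,j)$ of $\Upsilon$ is placed at the point $p_j+(k,-k)$. The vertex $(k,1)$ of $\bar{\mathcal F}$ is placed at $p_{n+1}+(k,-k)$ and the vertex $(k,i)$, $3\le i\le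 n$, at $p_{n+i-1}+(k,-k)$, $0\le k\le n$; thus $\bar{\mathcal F}$ is a part of $\Upsilon$ lying between $F$ and the path ${}^tF$ described next. **The transposed boundary.** ${}^t\Lambda'$ is the sequence $\Lambda'$ read from right to left with the letters $x$ and $y$ exchanged, and ${}^tF=x\,{}^t\Lambda'\,y$, with end points labelled $1$. It is drawn with the same step conventions as a lattice path $t_0,\dots,t_{2n}$ from $t_0=(n+1,-n-1)$ to $t_{2n}=(2n,0)$. Under transposition the vertex $t_j$ of ${}^tF$ ($1\le j\le 2n-1$) corresponds to the vertex $p_{2n-j}$ of $F$, and they have the same label; explicitly, if $p_{2n-j}=(a,b)$ then $t_j=(2n+1-b,-a-1)$. **Projections and words.** Let $(u,v)$ be a point of $\bar{\mathcal F}$ lying neither on $F$ nor on ${}^tF$. Its horizontal (resp. vertical) projection on $F$ is the nearest vertex of $F$ on its left in the same horizontal line (resp. above it in the same vertical line); its horizontal (resp. vertical) projection on ${}^tF$ is the nearest vertex of ${}^tF$ on its right in the same horizontal line (resp. below it in the same vertical line). Three situations cover all points of $\bar{\mathcal F}$ not on the boundaries: 1. Both projections lie on $F$ (this is $u\le n+1$, $v\ge0$): the word associated with $(u,v)$ is the portion of $F$ (labels and letters) from the horizontal projection to the vertical projection. 2. Both projections lie on ${}^tF$ (this is $u\ge n+2$, $v\le0$): the word is the portion of ${}^tF$ from the vertical projection to the horizontal projection, with the letters $x$ and $y$ interchanged (labels unchanged). 3. The horizontal projection lies on $F$ and the vertical projection lies on ${}^tF$ (this is $u\ge n+2$, $v\ge0$):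 the word is the portion of $F$ from the horizontal projection to the vertex of $F$ corresponding under transposition to the vertical projection. (When $u\ge n+2$ and $v=0$, both situations 2 and 3 describe the point, and either may be used.) In the word $b_0x_1b_1\cdots x_{m+1}b_{m+1}$ the $b_i$ are the labels of the successive vertices and the $x_i\in\{x,y\}$ the successive letters. *)

theory Defs
  imports
    "HOL-Analysis.Cartesian_Space"
    "HOL-Computational_Algebra.Fraction_Field"
    "HOL-Library.Poly_Mapping"
    "Graph_Theory.Digraph_Component"
begin

text \<open>
  The field of rational functions over the rationals in the variables \<open>u\<^sub>0, u\<^sub>1, u\<^sub>2, \<dots>\<close>.  A
  monomial is a finitely supported exponent vector, a polynomial a finitely supported family of
  coefficients indexed by monomials.  Only \<open>u\<^sub>1, \<dots>, u\<^sub>n\<close> occur in the initial values, so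
  the friezes below live in the subfield generated by these \<open>n\<close> independent variables.
\<close>

type_synonym ratfun = "((nat \<Rightarrow>\<^sub>0 nat) \<Rightarrow>\<^sub>0 rat) fract"

definition indet :: "nat \<Rightarrow> ratfun" where
  "indet i = Fract (Poly_Mapping.single (Poly_Mapping.single i 1) 1) 1"


section \<open>Translation quivers and friezes\<close>

text \<open>Quivers are the (multi-)digraphs of type \<^typ>\<open>('v, 'e) pre_digraph\<close>.\<close>

datatype 'e translation_arrow =
    Level int 'e  \<comment> \<open>\<open>(k,i) \<rightarrow> (k,j)\<close> for an arrow \<open>i \<rightarrow> j\<close>\<close>
  | Next int 'e   \<comment> \<open>\<open>(k,j) \<rightarrow> (k+1,i)\<close> for an arrow \<open>i \<rightarrow> j\<close>\<close>

fun translation_tail :: "('v, 'e) pre_digraph \<Rightarrow> 'e translation_arrow \<Rightarrow> int \<times> 'v" where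
  "translation_tail G (Level k e) = (k, tail G e)"
| "translation_tail G (Next k e) = (k, head G e)"

fun translation_head :: "('v, 'e) pre_digraph \<Rightarrow> 'e translation_arrow \<Rightarrow> int \<times> 'v" where
  "translation_head G (Level k e) = (k, head G e)"
| "translation_head G (Next k e) = (k + 1, tail G e)"

definition translation_quiver ::
    "('v, 'e) pre_digraph \<Rightarrow> (int \<times> 'v, 'e translation_arrow) pre_digraph" where
  "translation_quiver G =
    \<lparr> verts = UNIV \<times> verts G,
      arcs = {Level k e | k e. e \<in> arcs G} \<union> {Next k e | k e. e \<in> arcs G},
      tail = translation_tail G,
      head = translation_head G \<rparr>"

definition frieze_of ::
    "('v, 'e) pre_digraph \<Rightarrow> ('v \<Rightarrow> 'a::field) \<Rightarrow> (int \<times> 'v \<Rightarrow> 'a) \<Rightarrow> bool" where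
  "frieze_of G init a \<longleftrightarrow>
    (\<forall>i \<in> verts G. a (0, i) = init i) \<and>
    (\<forall>k. \<forall>i \<in> verts G.
      a (k, i) * a (k + 1, i) =
        1 + (\<Prod>e \<in> out_arcs (translation_quiver G) (k, i). a (head (translation_quiver G) e)))"


section \<open>Type D and the modelled quiver\<close>

definition D_edges :: "nat \<Rightarrow> nat set set" where
  "D_edges n = {{1, 3}, {2, 3}} \<union> {{i, i + 1} | i. 3 \<le> i \<and> i < n}"

definition type_D :: "nat \<Rightarrow> (nat, 'e) pre_digraph \<Rightarrow> bool" where
  "type_D n Q \<longleftrightarrow>
    verts Q = {1..n} \<and> bij_betw (\<lambda>e. {tail Q e, head Q e}) (arcs Q) (D_edges n)"

definition fork_arrows :: "(nat, 'e) pre_digraph \<Rightarrow> 'e set" where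
  "fork_arrows Q = {e \<in> arcs Q. {tail Q e, head Q e} \<in> {{1, 3}, {2, 3}}}"

definition modelled_verts :: "nat \<Rightarrow> (int \<times> nat) set" where
  "modelled_verts n = {0..int n} \<times> ({1} \<union> {3..n})"

definition modelled_value :: "(int \<times> nat \<Rightarrow> 'a::field) \<Rightarrow> int \<times> nat \<Rightarrow> 'a" where
  "modelled_value a = (\<lambda>(k, i). if i = 1 then a (k, 1) * a (k, 2) else a (k, i))"


section \<open>The quiver of type A and the boundaries\<close>

text \<open>
  In the left to right numbering \<open>1, \<dots>, 2n-1\<close> of the quiver of type A, \<open>slot n i\<close> is the number
  of the vertex \<open>i\<close> of \<open>omega_bar Q\<close> in its right-hand copy, and \<open>2n - slot n i\<close> its number in the
  redrawn left-hand copy.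
\<close>

definition slot :: "nat \<Rightarrow> nat \<Rightarrow> nat" where
  "slot n i = (if i = 1 then n + 1 else n + i - 1)"

definition omega_bar :: "(nat, 'e) pre_digraph \<Rightarrow> (nat, 'e) pre_digraph" where
  "omega_bar Q = Q \<restriction> (verts Q - {2})"

definition doubled_quiver :: "nat \<Rightarrow> (nat, 'e) pre_digraph \<Rightarrow> (nat, nat \<times> nat) pre_digraph" where
  "doubled_quiver n Q =
    \<lparr> verts = {1..2 * n - 1},
      arcs =
        (\<lambda>e. (2 * n - slot n (tail Q e), 2 * n - slot n (head Q e))) ` arcs (omega_bar Q) \<union>
        {(n - 1, n), (n, n + 1)} \<union>
        (\<lambda>e. (slot n (tail Q e), slot n (head Q e))) ` arcs (omega_bar Q),
      tail = fst,
      head = snd \<rparr>"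

definition boundary_labels :: "nat \<Rightarrow> (nat \<Rightarrow> 'a::field) \<Rightarrow> 'a list" where
  "boundary_labels n u =
    map u (rev [3..<n + 1]) @ [u 1 * u 2, 1, u 1 * u 2] @ map u [3..<n + 1]"

definition Upsilon_init :: "nat \<Rightarrow> (nat \<Rightarrow> 'a::field) \<Rightarrow> nat \<Rightarrow> 'a" where
  "Upsilon_init n u j = boundary_labels n u ! (j - 1)"

datatype letter = Lx | Ly

text \<open>
  A word \<open>b\<^sub>0 x\<^sub>1 b\<^sub>1 \<dots> x\<^sub>r b\<^sub>r\<close> is the pair of its list of labels \<open>[b\<^sub>0, \<dots>, b\<^sub>r]\<close> and its list of
  letters \<open>[x\<^sub>1, \<dots>, x\<^sub>r]\<close>; hence \<open>x\<^sub>i\<close> has list index \<open>i - 1\<close>.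
\<close>

type_synonym 'a word = "'a list \<times> letter list"

fun swap_letter :: "letter \<Rightarrow> letter" where
  "swap_letter Lx = Ly"
| "swap_letter Ly = Lx"

definition swap_letters :: "'a word \<Rightarrow> 'a word" where
  "swap_letters = (\<lambda>(bs, xs). (bs, map swap_letter xs))"

definition transpose_word :: "'a word \<Rightarrow> 'a word" where
  "transpose_word = (\<lambda>(bs, xs). (rev bs, map swap_letter (rev xs)))"

definition portion :: "'a word \<Rightarrow> nat \<Rightarrow> nat \<Rightarrow> 'a word" where
  "portion = (\<lambda>(bs, xs) i j. (take (j + 1 - i) (drop i bs), take (j - i) (drop i xs)))"

definition Lambda' :: "nat \<Rightarrow> (nat, 'e) pre_digraph \<Rightarrow> (nat \<Rightarrow> 'a::field) \<Rightarrow> 'a word" where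
  "Lambda' n Q u =
    (boundary_labels n u,
     map (\<lambda>j. if (j, j + 1) \<in> arcs (doubled_quiver n Q) then Lx else Ly) [1..<2 * n - 1])"

definition enclose :: "letter \<Rightarrow> 'a::field word \<Rightarrow> letter \<Rightarrow> 'a word" where
  "enclose l = (\<lambda>(bs, xs) r. (1 # bs @ [1], l # xs @ [r]))"

definition bdry_F :: "nat \<Rightarrow> (nat, 'e) pre_digraph \<Rightarrow> (nat \<Rightarrow> 'a::field) \<Rightarrow> 'a word" where
  "bdry_F n Q u = enclose Ly (Lambda' n Q u) Lx"

definition bdry_tF :: "nat \<Rightarrow> (nat, 'e) pre_digraph \<Rightarrow> (nat \<Rightarrow> 'a::field) \<Rightarrow> 'a word" where
  "bdry_tF n Q u = enclose Lx (transpose_word (Lambda' n Q u)) Ly"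


section \<open>Embedding in the plane\<close>

type_synonym point = "int \<times> int"

fun step :: "letter \<Rightarrow> point" where
  "step Lx = (1, 0)"
| "step Ly = (0, 1)"

definition lattice_path :: "point \<Rightarrow> letter list \<Rightarrow> nat \<Rightarrow> point" where
  "lattice_path s xs j = s + (\<Sum>i<j. step (xs ! i))"

definition path_F :: "nat \<Rightarrow> (nat, 'e) pre_digraph \<Rightarrow> (nat \<Rightarrow> 'a::field) \<Rightarrow> nat \<Rightarrow> point" where
  "path_F n Q u = lattice_path (0, 0) (snd (bdry_F n Q u))"

definition path_tF :: "nat \<Rightarrow> (nat, 'e) pre_digraph \<Rightarrow> (nat \<Rightarrow> 'a::field) \<Rightarrow> nat \<Rightarrow> point" where
  "path_tF n Q u = lattice_path (int n + 1, - int n - 1) (snd (bdry_tF n Q u))"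

definition on_boundary ::
    "nat \<Rightarrow> (nat, 'e) pre_digraph \<Rightarrow> (nat \<Rightarrow> 'a::field) \<Rightarrow> point \<Rightarrow> bool" where
  "on_boundary n Q u P \<longleftrightarrow> P \<in> path_F n Q u ` {0..2 * n} \<union> path_tF n Q u ` {0..2 * n}"

definition Upsilon_point ::
    "nat \<Rightarrow> (nat, 'e) pre_digraph \<Rightarrow> (nat \<Rightarrow> 'a::field) \<Rightarrow> int \<times> nat \<Rightarrow> point" where
  "Upsilon_point n Q u = (\<lambda>(k, j). path_F n Q u j + (k, - k))"

definition modelled_point ::
    "nat \<Rightarrow> (nat, 'e) pre_digraph \<Rightarrow> (nat \<Rightarrow> 'a::field) \<Rightarrow> int \<times> nat \<Rightarrow> point" where
  "modelled_point n Q u = (\<lambda>(k, i). Upsilon_point n Q u (k, slot n i))"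


section \<open>Projections and associated words\<close>

text \<open>
  The projections are given by the index of the vertex on the path, among the indices
  \<open>0, \<dots>, 2n\<close>.
\<close>

definition hproj_F where
  "hproj_F n Q u = (\<lambda>(x, y). is_arg_min (\<lambda>i. x - fst (path_F n Q u i))
    (\<lambda>i. i \<le> 2 * n \<and> snd (path_F n Q u i) = y \<and> fst (path_F n Q u i) < x))"

definition vproj_F where
  "vproj_F n Q u = (\<lambda>(x, y). is_arg_min (\<lambda>i. snd (path_F n Q u i) - y)
    (\<lambda>i. i \<le> 2 * n \<and> fst (path_F n Q u i) = x \<and> y < snd (path_F n Q u i)))"

definition hproj_tF where
  "hproj_tF n Q u = (\<lambda>(x, y). is_arg_min (\<lambda>i. fst (path_tF n Q u i) - x)
    (\<lambda>i. i \<le> 2 * n \<and> snd (path_tF n Q u i) = y \<and> x < fst (path_tF n Q u i)))"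

definition vproj_tF where
  "vproj_tF n Q u = (\<lambda>(x, y). is_arg_min (\<lambda>i. y - snd (path_tF n Q u i))
    (\<lambda>i. i \<le> 2 * n \<and> fst (path_tF n Q u i) = x \<and> snd (path_tF n Q u i) < y))"

text \<open>
  \<open>same_word\<close> covers the points with both projections on \<open>F\<close> or both on the transposed boundary,
  \<open>mixed_word\<close> those with one on each.  The inequalities decide which projections are meant where
  a line meets both paths: the line \<open>x = n + 1\<close> counts for \<open>F\<close>, and points with \<open>y = 0\<close>,
  \<open>x \<ge> n + 2\<close> have a word of both kinds.
\<close>

inductive same_word ::
    "nat \<Rightarrow> (nat, 'e) pre_digraph \<Rightarrow> (nat \<Rightarrow> 'a::field) \<Rightarrow> point \<Rightarrow> 'a word \<Rightarrow> bool"
  for n Q u where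
  on_F: "\<lbrakk>\<not> on_boundary n Q u (x, y); x \<le> int n + 1; 0 \<le> y;
      hproj_F n Q u (x, y) i; vproj_F n Q u (x, y) j\<rbrakk>
    \<Longrightarrow> same_word n Q u (x, y) (portion (bdry_F n Q u) i j)"
| on_tF: "\<lbrakk>\<not> on_boundary n Q u (x, y); int n + 2 \<le> x; y \<le> 0;
      vproj_tF n Q u (x, y) i; hproj_tF n Q u (x, y) j\<rbrakk>
    \<Longrightarrow> same_word n Q u (x, y) (swap_letters (portion (bdry_tF n Q u) i j))"

text \<open>The vertex of \<open>F\<close> corresponding under transposition to the vertex \<open>j\<close> has index \<open>2n - j\<close>.\<close>

inductive mixed_word ::
    "nat \<Rightarrow> (nat, 'e) pre_digraph \<Rightarrow> (nat \<Rightarrow> 'a::field) \<Rightarrow> point \<Rightarrow> 'a word \<Rightarrow> bool"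
  for n Q u where
  "\<lbrakk>\<not> on_boundary n Q u (x, y); int n + 2 \<le> x; 0 \<le> y;
      hproj_F n Q u (x, y) i; vproj_tF n Q u (x, y) j\<rbrakk>
    \<Longrightarrow> mixed_word n Q u (x, y) (portion (bdry_F n Q u) i (2 * n - j))"


section \<open>The matrix formula\<close>

fun M_matrix :: "'a::field \<Rightarrow> letter \<Rightarrow> 'a \<Rightarrow> 'a^2^2" where
  "M_matrix a Lx b = vector [vector [a, 1], vector [0, b]]"
| "M_matrix a Ly b = vector [vector [b, 0], vector [1, a]]"

definition word_m :: "'a word \<Rightarrow> nat" where
  "word_m w = length (snd w) - 1"

definition word_matrix :: "'a::field word \<Rightarrow> 'a^2^2" where
  "word_matrix w =
    foldr (\<lambda>i A. M_matrix (fst w ! (i - 1)) (snd w ! (i - 1)) (fst w ! i) ** A)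
      [2..<word_m w + 1] (mat 1)"

definition word_formula :: "'a::field word \<Rightarrow> 'a^2 \<Rightarrow> 'a" where
  "word_formula w c =
    1 / (\<Prod>i = 1..word_m w. fst w ! i) *
    (\<Sum>r\<in>UNIV. (vector [1, fst w ! 0] v* word_matrix w) $ r * c $ r)"

text \<open>
  \<open>T_value n Q u ups P z\<close> says that one of the clauses defining \<open>T\<close> yields the value \<open>z\<close> at the
  point \<open>P\<close>, where \<open>ups\<close> is the frieze on \<open>doubled_quiver n Q\<close>.  A relation is used since two
  clauses may apply to the same point.
\<close>

inductive T_value ::
    "nat \<Rightarrow> (nat, 'e) pre_digraph \<Rightarrow> (nat \<Rightarrow> 'a::field) \<Rightarrow> (int \<times> nat \<Rightarrow> 'a) \<Rightarrow>
      point \<Rightarrow> 'a \<Rightarrow> bool"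
  for n Q u ups where
  boundary: "\<lbrakk>on_boundary n Q u P; j \<in> {1..2 * n - 1}; P = Upsilon_point n Q u (k, j)\<rbrakk>
    \<Longrightarrow> T_value n Q u ups P (ups (k, j))"
| same: "same_word n Q u P w
    \<Longrightarrow> T_value n Q u ups P (word_formula w (vector [1, fst w ! (word_m w + 1)]))"
| mixed: "mixed_word n Q u P w
    \<Longrightarrow> T_value n Q u ups P (word_formula w (vector [fst w ! (word_m w + 1), 1]))"

end

theory Submission
  imports Defs
begin


text \<open>
  A frieze of type \<open>A\<^bsub>2n-1\<^esub>\<close> is given by plane vectors \<open>v\<^sub>i\<close>, \<open>i \<in> \<int>\<close>, with
  \<open>det(v\<^sub>i, v\<^bsub>i+1\<^esub>) = 1\<close> and \<open>v\<^bsub>i+2n+2\<^esub> = -v\<^sub>i\<close>: its value at the point \<open>(x, y)\<close> is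
  \<open>det(v\<^bsub>-y-1\<^esub>, v\<^sub>x)\<close>, the frieze relation being a Pluecker relation.  The matrix product
  of a word expands the vector of one end of the word in terms of the vectors met along the
  path, so both matrix formulas evaluate to such a determinant.

  The boundary is symmetric about its central label 1.  Hence \<open>v\<^sub>i \<mapsto> v\<^bsub>i+n\<^esub>\<close> is, on a range of
  \<open>n + 1\<close> indices, a linear map of determinant 1, and it has trace 2.  The trace identity says
  that in the row next to the centre the factor \<open>1 + r\<cdot>s\<close> of the type A relation is
  \<open>1 + r(r + 2) = (1 + r)\<^sup>2\<close>, which is the product of the type D relations at the two ends of
  the fork.  So the modelled quiver satisfies the relations of the frieze of type A.
\<close>

section \<open>A positive cone of rational functions\<close>

text \<open>A frieze relation yields the next value only after division by the previous one, and
  nothing prevents a determinant from vanishing. This is the purpose of the positive cone: it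
  contains 1 and the variables, it is stable under the operations of the recursion, which only adds,
  multiplies and divides, and it does not contain 0. Nonvanishing is obtained for the determinants
  by way of the type A frieze; the modelled quiver is then compared with determinants already known
  to be nonzero. In the row next to the centre, one of the two neighbouring rows of the type A
  relation is the central row, which the modelled quiver does not contain. The trace identity
  eliminates exactly this unknown factor. The symmetry compares the two halves of one period, so it
  controls the shift by n on n + 1 indices only. These form n consecutive pairs, one for each
  passage from level k to level k + 1 with 0 \<le> k < n. Hence the comparison reaches level n,
  where the points lie on the transposed boundary.\<close>

definition nonneg_poly :: "('a::zero \<Rightarrow>\<^sub>0 'b::linordered_field) \<Rightarrow> bool" where
  "nonneg_poly p \<longleftrightarrow> (\<forall>m. 0 \<le> Poly_Mapping.lookup p m)"

lemma nonneg_poly_add: "nonneg_poly p \<Longrightarrow> nonneg_poly q \<Longrightarrow> nonneg_poly (p + q)"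
  by (simp add: nonneg_poly_def lookup_add)

text \<open>Nonnegative coefficients cannot cancel: any monomial of \<open>p\<close> survives in the
  sum. Stability of the cone under addition rests on this.\<close>

lemma nonneg_poly_add_nonzero:
  assumes "nonneg_poly p" "nonneg_poly q" "p \<noteq> 0"
  shows "p + q \<noteq> 0"
proof -
  obtain m where "Poly_Mapping.lookup p m \<noteq> 0"
    using assms(3) by (metis poly_mapping_eqI lookup_zero)
  then have "0 < Poly_Mapping.lookup (p + q) m"
    using assms(1,2) by (metis add_pos_nonneg lookup_add nonneg_poly_def order_le_less)
  then show ?thesis
    by auto
qed

lemma Sum_any_nonneg: "(\<And>x. 0 \<le> f x) \<Longrightarrow> 0 \<le> Sum_any f" for f :: "'a \<Rightarrow> 'b::ordered_comm_monoid_add"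
  unfolding Sum_any.expand_set by (rule sum_nonneg) auto

lemma nonneg_poly_mult:
  fixes p q :: "'a::monoid_add \<Rightarrow>\<^sub>0 'b::linordered_field"
  assumes "nonneg_poly p" "nonneg_poly q"
  shows "nonneg_poly (p * q)"
  using assms unfolding nonneg_poly_def lookup_mult
  by (auto intro!: Sum_any_nonneg mult_nonneg_nonneg simp: when_def)

text \<open>One representation of this kind is enough, so that 1 - u + u^2 = (1 + u^3)/(1 + u)
  belongs to the cone. This makes it stable under division, which polynomials with nonnegative
  coefficients are not.\<close>

definition positive_cone :: "ratfun set" where
  "positive_cone =
    {Fract p q | p q. nonneg_poly p \<and> nonneg_poly q \<and> p \<noteq> 0 \<and> q \<noteq> 0}"

lemma positive_coneI:
  "nonneg_poly p \<Longrightarrow> nonneg_poly q \<Longrightarrow> p \<noteq> 0 \<Longrightarrow> q \<noteq> 0 \<Longrightarrow> Fract p q \<in> positive_cone"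
  unfolding positive_cone_def by blast

lemma positive_coneE:
  assumes "f \<in> positive_cone"
  obtains p q where "f = Fract p q" "nonneg_poly p" "nonneg_poly q" "p \<noteq> 0" "q \<noteq> 0"
  using assms unfolding positive_cone_def by blast

lemma positive_cone_nonzero: "0 \<notin> positive_cone"
proof
  assume "0 \<in> positive_cone"
  then obtain p q :: "(nat \<Rightarrow>\<^sub>0 nat) \<Rightarrow>\<^sub>0 rat" where "0 = Fract p q" "p \<noteq> 0" "q \<noteq> 0"
    by (auto elim: positive_coneE)
  then show False
    by (simp add: Zero_fract_def eq_fract)
qed

lemma positive_cone_add:
  assumes "f \<in> positive_cone" "g \<in> positive_cone"
  shows "f + g \<in> positive_cone"
proof -
  obtain p q where f: "f = Fract p q" "nonneg_poly p" "nonneg_poly q" "p \<noteq> 0" "q \<noteq> 0"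
    using assms(1) by (rule positive_coneE)
  obtain r s where g: "g = Fract r s" "nonneg_poly r" "nonneg_poly s" "r \<noteq> 0" "s \<noteq> 0"
    using assms(2) by (rule positive_coneE)
  have "f + g = Fract (p * s + r * q) (q * s)"
    using f g by simp
  moreover have "p * s + r * q \<noteq> 0"
    using f g by (intro nonneg_poly_add_nonzero nonneg_poly_mult) auto
  ultimately show ?thesis
    using f g by (auto intro!: positive_coneI nonneg_poly_add nonneg_poly_mult)
qed

lemma positive_cone_mult:
  assumes "f \<in> positive_cone" "g \<in> positive_cone"
  shows "f * g \<in> positive_cone"
  using assms by (auto elim!: positive_coneE intro!: positive_coneI nonneg_poly_mult)

lemma positive_cone_divide:
  assumes "f \<in> positive_cone" "g \<in> positive_cone"
  shows "f / g \<in> positive_cone"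
  using assms by (auto elim!: positive_coneE intro!: positive_coneI nonneg_poly_mult)

lemma nonneg_poly_single: "0 \<le> c \<Longrightarrow> nonneg_poly (Poly_Mapping.single m c)"
  by (simp add: nonneg_poly_def Poly_Mapping.lookup_single when_def)

lemma nonneg_poly_one: "nonneg_poly 1"
  by (metis nonneg_poly_single single_one zero_le_one)

lemma positive_cone_one: "1 \<in> positive_cone"
  unfolding One_fract_def by (intro positive_coneI nonneg_poly_one) simp_all

lemma single_nonzero: "c \<noteq> 0 \<Longrightarrow> Poly_Mapping.single m c \<noteq> 0"
  by (metis lookup_single_eq lookup_zero)

lemma positive_cone_indet: "indet i \<in> positive_cone"
  unfolding indet_def
  by (intro positive_coneI nonneg_poly_one nonneg_poly_single single_nonzero) simp_all


section \<open>Frieze strips from sequences of plane vectors\<close>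

definition cross :: "'a::field \<times> 'a \<Rightarrow> 'a \<times> 'a \<Rightarrow> 'a" where
  "cross p q = fst p * snd q - snd p * fst q"

lemma cross_self [simp]: "cross p p = 0"
  by (simp add: cross_def mult.commute)

lemma cross_minus_left [simp]: "cross (- p) q = - cross p q"
  and cross_minus_right [simp]: "cross p (- q) = - cross p q"
  by (simp_all add: cross_def)

lemma cross_commute: "cross p q = - cross q p"
  by (simp add: cross_def mult.commute)

text \<open>The three-term relation for four plane vectors. The frieze relation and each step along
  a word are instances of it.\<close>

lemma pluecker: "cross p q * cross r s = cross p s * cross r q + cross p r * cross q s"
  by (simp add: cross_def algebra_simps)

text \<open>By Cramer's rule, the determinants against two independent vectors are the coordinates
  of a plane vector up to a common factor.\<close>

lemma cross_eqI:
  assumes "cross p u = cross p w" "cross u q = cross w q" "cross p q \<noteq> 0"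
  shows "u = w"
proof -
  have "cross p q * fst u = cross p u * fst q + cross u q * fst p"
    "cross p q * snd u = cross p u * snd q + cross u q * snd p" for u
    by (simp_all add: cross_def algebra_simps)
  then show ?thesis
    using assms by (metis mult_left_cancel prod_eqI)
qed

text \<open>The path is followed step by step. A step to the right adds a vector at the upper end of
  the index range, a step up adds one at the lower end. The new vector is fixed by two determinants:
  1 with its neighbour and the new label with the vector at the opposite end.\<close>

lemma ex_strip:
  fixes b :: "nat \<Rightarrow> 'a::field" and X Y :: "nat \<Rightarrow> int"
  assumes start: "X 0 = 0" "Y 0 = 0"
    and steps: "\<And>j. X (Suc j) = X j + (if S j then 1 else 0)"
      "\<And>j. Y (Suc j) = Y j + (if S j then 0 else 1)"
    and b: "b 0 = 1" "\<And>j. j < N \<Longrightarrow> b j \<noteq> 0"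
  shows "\<exists>w :: int \<Rightarrow> 'a \<times> 'a.
    (\<forall>i. - Y N - 1 \<le> i \<and> i < X N \<longrightarrow> cross (w i) (w (i + 1)) = 1) \<and>
    (\<forall>j\<le>N. cross (w (- Y j - 1)) (w (X j)) = b j)"
  using b(2)
proof (induction N)
  case 0
  have "- Y 0 - 1 \<le> i \<and> i < X 0 \<longleftrightarrow> i = -1" for i
    using start by auto
  \<comment> \<open>The start of the path involves only the indices -1 and 0; they receive the
    standard basis, of determinant \<open>b 0 = 1\<close>.\<close>
  then show ?case
    using start b(1) by (intro exI[of _ "\<lambda>i. if i = 0 then (0, 1) else (1, 0)"]) (auto simp: cross_def)
next
  case (Suc N)
  then obtain w where w: "\<And>i. - Y N - 1 \<le> i \<Longrightarrow> i < X N \<Longrightarrow> cross (w i) (w (i + 1)) = 1"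
    "\<And>j. j \<le> N \<Longrightarrow> cross (w (- Y j - 1)) (w (X j)) = b j"
    using Suc.IH[OF Suc.prems] less_SucI by blast
  have bN: "b N \<noteq> 0"
    using Suc.prems by simp
  have mono: "X j \<le> X N" "Y j \<le> Y N" "0 \<le> X j" "0 \<le> Y j" if "j \<le> N" for j
  proof -
    show "X j \<le> X N" "Y j \<le> Y N"
      using that lift_Suc_mono_le[of X j N] lift_Suc_mono_le[of Y j N] by (simp_all add: steps)
    show "0 \<le> X j" "0 \<le> Y j"
      using lift_Suc_mono_le[of X 0 j] lift_Suc_mono_le[of Y 0 j] start by (simp_all add: steps)
  qed
  let ?A = "w (X N)" and ?B = "w (- Y N - 1)"
  have BA: "cross ?B ?A = b N"
    using w(2) by simp
  show ?case
  proof (cases "S N")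
    case True
    \<comment> \<open>The solution, in the basis \<open>?A\<close>, \<open>?B\<close>, of
      \<open>cross ?A A' = 1\<close> and \<open>cross ?B A' = b (Suc N)\<close>.\<close>
    define A' where "A' = ((b (Suc N) * fst ?A - fst ?B) / b N, (b (Suc N) * snd ?A - snd ?B) / b N)"
    have c: "cross p A' = (b (Suc N) * cross p ?A - cross p ?B) / b N" for p
      using bN by (simp add: A'_def cross_def field_simps)
    have A': "cross ?A A' = 1" "cross ?B A' = b (Suc N)"
      using bN BA cross_commute[of ?A ?B] by (simp_all add: c)
    let ?w = "w(X N + 1 := A')"
    have "cross (?w i) (?w (i + 1)) = 1" if "- Y (Suc N) - 1 \<le> i" "i < X (Suc N)" for i
      using that w(1)[of i] A' True by (cases "i = X N") (auto simp: steps)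
    moreover have "cross (?w (- Y j - 1)) (?w (X j)) = b j" if "j \<le> Suc N" for j
    proof (cases "j = Suc N")
      case True
      have "- Y N - 1 \<noteq> X N + 1" using mono[of N] by simp
      then show ?thesis using True A' \<open>S N\<close> by (simp add: steps)
    next
      case False
      then have "j \<le> N" using that by simp
      moreover have "- Y j - 1 \<noteq> X N + 1" "X j \<noteq> X N + 1" using mono[of N] mono[of j] calculation by simp_all
      ultimately show ?thesis using w(2) by simp
    qed
    ultimately show ?thesis by blast
  next
    case False
    \<comment> \<open>The same with the ends exchanged: the solution of
      \<open>cross B' ?B = 1\<close> and \<open>cross B' ?A = b (Suc N)\<close>.\<close>
    define B' where "B' = ((b (Suc N) * fst ?B - fst ?A) / b N, (b (Suc N) * snd ?B - snd ?A) / b N)"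
    have c: "cross B' p = (b (Suc N) * cross ?B p - cross ?A p) / b N" for p
      using bN by (simp add: B'_def cross_def field_simps)
    have B': "cross B' ?B = 1" "cross B' ?A = b (Suc N)"
      using bN BA cross_commute[of ?A ?B] by (simp_all add: c)
    let ?w = "w(- Y N - 2 := B')"
    have "cross (?w i) (?w (i + 1)) = 1" if "- Y (Suc N) - 1 \<le> i" "i < X (Suc N)" for i
    proof (cases "i = - Y N - 2")
      case True
      have "- Y N - 2 + 1 = - Y N - 1" by simp
      then show ?thesis unfolding True using B' by (simp only: fun_upd_same) simp
    next
      case False
      then show ?thesis using that w(1)[of i] \<open>\<not> S N\<close> by (auto simp: steps)
    qed
    moreover have "cross (?w (- Y j - 1)) (?w (X j)) = b j" if "j \<le> Suc N" for j
    proof (cases "j = Suc N")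
      case True
      have "- Y N - 2 \<noteq> X N" using mono[of N] by simp
      then show ?thesis using True B' \<open>\<not> S N\<close> by (simp add: steps)
    next
      case False
      then have "j \<le> N" using that by simp
      moreover have "- Y j - 1 \<noteq> - Y N - 2" "X j \<noteq> - Y N - 2" using mono[of N] mono[of j] calculation by simp_all
      ultimately show ?thesis using w(2) by simp
    qed
    ultimately show ?thesis by blast
  qed
qed

text \<open>At the seam \<open>w d\<close> is followed by \<open>- w c\<close>, and their
  determinant is \<open>cross (w c) (w d)\<close>. The condition on the ends is thus the missing
  case of the consecutive determinants.\<close>

lemma antiperiodic_extension:
  fixes w :: "int \<Rightarrow> 'a::field \<times> 'a" and c d T :: int
  assumes T: "T = d - c + 1" "0 < T"
    and cons: "\<And>i. c \<le> i \<Longrightarrow> i < d \<Longrightarrow> cross (w i) (w (i + 1)) = 1"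
    and ends: "cross (w c) (w d) = 1"
  obtains v where "\<And>i. c \<le> i \<Longrightarrow> i \<le> d \<Longrightarrow> v i = w i"
    "\<And>i. v (i + T) = - v i" "\<And>i. cross (v i) (v (i + 1)) = 1"
proof
  define v where
    "v i = (if even ((i - c) div T) then w ((i - c) mod T + c) else - w ((i - c) mod T + c))" for i
  show base: "v i = w i" if "c \<le> i" "i \<le> d" for i
    using that T by (simp add: v_def div_pos_pos_trivial)
  show shift: "v (i + T) = - v i" for i
  proof -
    have "i + T - c = (i - c) + T" by simp
    then have "(i + T - c) div T = (i - c) div T + 1" "(i + T - c) mod T = (i - c) mod T"
      using T(2) by (simp_all only: div_add_self2 mod_add_self2)
    then show ?thesis by (simp add: v_def)
  qed
  have nat_shift: "v (i + int m * T) = (if even m then v i else - v i)" for i m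
  proof (induction m)
    case (Suc m)
    then show ?case using shift[of "i + int m * T"] by (simp add: algebra_simps)
  qed simp
  have main: "cross (v i) (v (i + 1)) = 1" if "c \<le> i" "i \<le> d" for i
  proof (cases "i = d")
    case True
    have "v (d + 1) = - v c" using shift[of c] T by simp
    then show ?thesis
      using True base[of c] base[of d] ends T cross_commute[of "w d" "w c"] by simp
  next
    case False
    then show ?thesis using that base[of i] base[of "i + 1"] cons[of i] by simp
  qed
  show "cross (v i) (v (i + 1)) = 1" for i
  proof -
    define r where "r = (i - c) mod T + c"
    define q where "q = (i - c) div T"
    have i: "i = r + q * T" unfolding r_def q_def by simp
    have r: "c \<le> r" "r \<le> d" using T pos_mod_bound[of T "i - c"] pos_mod_sign[of T "i - c"] by (auto simp: r_def)
    show ?thesis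
    proof (cases "0 \<le> q")
      case True
      then obtain m where "q = int m" by (rule nonneg_int_cases)
      then have "v i = (if even m then v r else - v r)" "v (i + 1) = (if even m then v (r + 1) else - v (r + 1))"
        using nat_shift[of r m] nat_shift[of "r + 1" m] by (simp_all add: i algebra_simps)
      then show ?thesis using main[OF r] by simp
    next
      case False
      then have "q = - int (nat (- q))" by simp
      then obtain m where "q = - int m" by blast
      then have "v r = (if even m then v i else - v i)" "v (r + 1) = (if even m then v (i + 1) else - v (i + 1))"
        using nat_shift[of i m] nat_shift[of "i + 1" m] by (simp_all add: i algebra_simps)
      then show ?thesis using main[OF r] by (simp split: if_splits)
    qed
  qed
qed



section \<open>Evaluating the matrix formula along a word\<close>

text \<open>The pair \<open>(e, g)\<close> is the row vector of the partial matrix product divided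
  by the labels already passed: multiplying it by the matrix of the letter gives \<open>b\<close>
  times \<open>(e', g')\<close>. The equations are kept free of division.\<close>

fun word_step :: "letter \<Rightarrow> 'a::field \<Rightarrow> 'a \<Rightarrow> 'a \<Rightarrow> 'a \<Rightarrow> 'a \<Rightarrow> 'a \<Rightarrow> bool" where
  "word_step Lx b b' e g e' g' \<longleftrightarrow> e' = e \<and> b * g' = e + b' * g"
| "word_step Ly b b' e g e' g' \<longleftrightarrow> g' = g \<and> b * e' = b' * e + g"

lemma row_times_foldr_matrices:
  "r v* foldr (\<lambda>i A. M i ** A) is (mat 1) = foldl (\<lambda>r i. r v* M i) r is"
  for r :: "'a::comm_semiring_1^'n"
  by (induction "is" arbitrary: r) (simp_all add: vector_matrix_mul_assoc[symmetric])

lemma row_times_M_matrix: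
  "vector [p * e, p * g] v* M_matrix b l b' = (vector [p * b * e', p * b * g'] :: 'a::field^2)"
  if "word_step l b b' e g e' g'"
proof -
  have assoc: "p * b * e' = p * (b * e')" "p * b * g' = p * (b * g')"
    by (simp_all add: mult.assoc)
  show ?thesis
  proof (cases l)
    case Lx
    then have "e' = e" "p * b * g' = p * (e + b' * g)"
      using that assoc by auto
    then show ?thesis
      by (simp add: Lx vec_eq_iff forall_2 sum_2 vector_matrix_mult_def algebra_simps)
  next
    case Ly
    then have "g' = g" "p * b * e' = p * (b' * e + g)"
      using that assoc by auto
    then show ?thesis
      by (simp add: Ly vec_eq_iff forall_2 sum_2 vector_matrix_mult_def algebra_simps)
  qed
qed

text \<open>Each matrix contributes a factor equal to its left label, so the denominator of the
  formula cancels up to its last factor, the label of index \<open>m\<close>.\<close>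

lemma word_formula_eq:
  fixes bs :: "'a::field list"
  assumes len: "length xs = Suc m" "1 \<le> m"
    and nz: "\<And>i. 1 \<le> i \<Longrightarrow> i \<le> m \<Longrightarrow> bs ! i \<noteq> 0"
    and start: "e 1 = 1" "g 1 = bs ! 0"
    and steps: "\<And>i. 1 \<le> i \<Longrightarrow> i < m \<Longrightarrow>
      word_step (xs ! i) (bs ! i) (bs ! Suc i) (e i) (g i) (e (Suc i)) (g (Suc i))"
  shows "word_formula (bs, xs) (vector [c, d]) = (e m * c + g m * d) / bs ! m"
proof -
  have m: "word_m (bs, xs) = m"
    using len by (simp add: word_m_def)
  define M where "M i = M_matrix (bs ! (i - 1)) (xs ! (i - 1)) (bs ! i)" for i
  have row: "foldl (\<lambda>r i. r v* M i) (vector [1, bs ! 0]) [2..<Suc k] =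
      (vector [(\<Prod>i = 1..<k. bs ! i) * e k, (\<Prod>i = 1..<k. bs ! i) * g k] :: 'a^2)"
    if "1 \<le> k" "k \<le> m" for k
    using that
  proof (induction k rule: dec_induct)
    case base
    then show ?case using start by simp
  next
    case (step k)
    have "[2..<Suc (Suc k)] = [2..<Suc k] @ [Suc k]"
      using step by simp
    then have "foldl (\<lambda>r i. r v* M i) (vector [1, bs ! 0]) [2..<Suc (Suc k)] =
      vector [(\<Prod>i = 1..<k. bs ! i) * e k, (\<Prod>i = 1..<k. bs ! i) * g k] v*
        M_matrix (bs ! k) (xs ! k) (bs ! Suc k)"
      using step by (simp add: M_def)
    also have "\<dots> = vector [(\<Prod>i = 1..<k. bs ! i) * bs ! k * e (Suc k),
        (\<Prod>i = 1..<k. bs ! i) * bs ! k * g (Suc k)]"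
      by (rule row_times_M_matrix) (use steps step in simp)
    finally show ?case
      using step by (simp add: prod.atLeastLessThan_Suc)
  qed
  let ?P = "\<Prod>i = 1..<m. bs ! i"
  have "(\<Prod>i = 1..m. bs ! i) = ?P * bs ! m"
    using len by (simp add: prod.last_plus flip: atLeastLessThanSuc_atLeastAtMost)
  moreover have "?P \<noteq> 0"
    using nz by simp
  moreover have "vector [1, bs ! 0] v* word_matrix (bs, xs) = (vector [?P * e m, ?P * g m] :: 'a^2)"
    using row[of m] len unfolding word_matrix_def m
    by (simp add: row_times_foldr_matrices M_def)
  ultimately show ?thesis
    using nz[of m] len by (simp add: word_formula_def m sum_2 field_simps)
qed

lemma
  assumes "i \<le> j" "j < length bs" "j \<le> length xs"
  shows length_portion: "length (snd (portion (bs, xs) i j)) = j - i"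
    and word_m_portion: "word_m (portion (bs, xs) i j) = j - i - 1"
    and fst_portion_nth: "r \<le> j - i \<Longrightarrow> fst (portion (bs, xs) i j) ! r = bs ! (i + r)"
    and snd_portion_nth: "r < j - i \<Longrightarrow> snd (portion (bs, xs) i j) ! r = xs ! (i + r)"
  using assms by (simp_all add: portion_def word_m_def)

lemma swap_letters_portion:
  "swap_letters (portion (bs, xs) i j) = portion (bs, map swap_letter xs) i j"
  by (simp add: swap_letters_def portion_def take_map drop_map)

text \<open>The row and the column at the ends of the formula are steps in disguise. An initial
  letter y turns the pair \<open>(0, bs ! i)\<close> into the row (1, b) with b the first label, and
  the column together with the remaining division by the last inner label computes the component
  that changes in a final step x or y. Hence one recursion over the whole portion, ends
  included.\<close>

lemma portion_formula:
  fixes bs :: "'a::field list"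
  assumes ij: "i + 2 \<le> j" "j < length bs" "j \<le> length xs"
    and nz: "\<And>r. r < length bs \<Longrightarrow> bs ! r \<noteq> 0"
    and start: "e i = 0" "g i = bs ! i" "xs ! i = Ly"
    and steps: "\<And>r. i \<le> r \<Longrightarrow> r < j \<Longrightarrow>
      word_step (xs ! r) (bs ! r) (bs ! Suc r) (e r) (g r) (e (Suc r)) (g (Suc r))"
    and w: "w = portion (bs, xs) i j"
  shows portion_formula_Lx:
      "xs ! (j - 1) = Lx \<Longrightarrow> word_formula w (vector [1, fst w ! (word_m w + 1)]) = g j"
    and portion_formula_Ly:
      "xs ! (j - 1) = Ly \<Longrightarrow> word_formula w (vector [fst w ! (word_m w + 1), 1]) = e j"
proof -
  define m where "m = j - i - 1"
  have m: "word_m w = m" "fst w ! (word_m w + 1) = bs ! j" "i + m = j - 1" "Suc (j - 1) = j"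
    using ij by (simp_all add: w word_m_portion fst_portion_nth m_def)
  have first: "e (Suc i) = 1" "g (Suc i) = bs ! i"
    using steps[of i] start nz[of i] ij by auto
  have formula: "word_formula w (vector [c, d]) = (e (i + m) * c + g (i + m) * d) / bs ! (i + m)" for c d
  proof -
    have "word_formula (fst w, snd w) (vector [c, d]) = (e (i + m) * c + g (i + m) * d) / fst w ! m"
    proof (rule word_formula_eq[where e = "\<lambda>r. e (i + r)" and g = "\<lambda>r. g (i + r)"])
      show "length (snd w) = Suc m" "1 \<le> m"
        using ij by (simp_all add: w length_portion m_def)
      show "fst w ! r \<noteq> 0" if "r \<le> m" for r
        using that ij nz by (simp add: w fst_portion_nth m_def)
      show "e (i + 1) = 1" "g (i + 1) = fst w ! 0"
        using first ij by (simp_all add: w fst_portion_nth)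
      show "word_step (snd w ! r) (fst w ! r) (fst w ! Suc r) (e (i + r)) (g (i + r))
          (e (i + Suc r)) (g (i + Suc r))" if "r < m" for r
        using that ij steps[of "i + r"] by (simp add: w fst_portion_nth snd_portion_nth m_def)
    qed
    moreover have "fst w ! m = bs ! (i + m)"
      using ij by (simp add: w fst_portion_nth m_def)
    ultimately show ?thesis by simp
  qed
  have last: "word_step (xs ! (j - 1)) (bs ! (j - 1)) (bs ! j) (e (j - 1)) (g (j - 1)) (e j) (g j)"
    using steps[of "j - 1"] ij m(4) by simp
  have nz': "bs ! (j - 1) \<noteq> 0"
    using nz[of "j - 1"] ij by simp
  show "word_formula w (vector [1, fst w ! (word_m w + 1)]) = g j" if "xs ! (j - 1) = Lx"
    using last that nz' by (simp add: formula m(3) m(2)[simplified] field_simps)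
  show "word_formula w (vector [fst w ! (word_m w + 1), 1]) = e j" if "xs ! (j - 1) = Ly"
    using last that nz' by (simp add: formula m(3) m(2)[simplified] field_simps)
qed



section \<open>The symmetric boundary in the plane\<close>

lemma lattice_path_Suc: "lattice_path s xs (Suc j) = lattice_path s xs j + step (xs ! j)"
  by (simp add: lattice_path_def add.assoc)

lemma lattice_path_0: "lattice_path s xs 0 = s"
  by (simp add: lattice_path_def)

lemma fst_snd_step:
  "fst (step l) = (if l = Lx then 1 else 0)" "snd (step l) = (if l = Lx then 0 else 1)"
  by (cases l; simp)+

lemma letter_not_Lx: "l \<noteq> Lx \<longleftrightarrow> l = Ly"
  by (cases l) auto

text \<open>The word is symmetric under reversal with x and y exchanged, apart from its two central
  letters, which are both x; hence \<open>L_sym\<close> stops before them. The end letters of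
  \<open>tL\<close> are given separately, since the letters added to the transposed word are not the
  transposes of those added to the original one.\<close>

locale symmetric_boundary =
  fixes n :: nat and L tL :: "letter list" and b tb :: "'a::field list"
  assumes n: "2 \<le> n"
    and length_L: "length L = 2 * n" and length_b: "length b = 2 * n + 1"
    and length_tL: "length tL = 2 * n" and length_tb: "length tb = 2 * n + 1"
    and L_first: "L ! 0 = Ly" and L_center: "L ! (n - 1) = Lx" "L ! n = Lx"
    and L_sym: "\<And>j. j < n - 1 \<Longrightarrow> L ! (2 * n - 1 - j) = swap_letter (L ! j)"
    and tL_ends: "tL ! 0 = Lx" "tL ! (2 * n - 1) = Ly"
    and tL_nth: "\<And>j. 1 \<le> j \<Longrightarrow> j \<le> 2 * n - 2 \<Longrightarrow> tL ! j = swap_letter (L ! (2 * n - 1 - j))"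
    and b_first: "b ! 0 = 1" and b_center: "b ! n = 1"
    and b_sym: "\<And>j. j \<le> 2 * n \<Longrightarrow> b ! (2 * n - j) = b ! j"
    and tb_nth: "\<And>j. j \<le> 2 * n \<Longrightarrow> tb ! j = b ! j"
    and b_nonzero: "\<And>j. j \<le> 2 * n \<Longrightarrow> b ! j \<noteq> 0"
begin

definition "X j = fst (lattice_path (0, 0) L j)"
definition "Y j = snd (lattice_path (0, 0) L j)"
definition "TX j = fst (lattice_path (int n + 1, - int n - 1) tL j)"
definition "TY j = snd (lattice_path (int n + 1, - int n - 1) tL j)"

lemma start: "X 0 = 0" "Y 0 = 0" "TX 0 = int n + 1" "TY 0 = - int n - 1"
  by (simp_all add: X_def Y_def TX_def TY_def lattice_path_0)

lemma steps:
  "X (Suc j) = X j + (if L ! j = Lx then 1 else 0)"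
  "Y (Suc j) = Y j + (if L ! j = Lx then 0 else 1)"
  "TX (Suc j) = TX j + (if tL ! j = Lx then 1 else 0)"
  "TY (Suc j) = TY j + (if tL ! j = Lx then 0 else 1)"
  by (simp_all add: X_def Y_def TX_def TY_def lattice_path_Suc fst_snd_step)

lemma coordinate_sum: "X j + Y j = int j" "TX j + TY j = int j"
  by (induction j) (auto simp: start steps)

lemma mono:
  assumes "i \<le> j"
  shows "X i \<le> X j" "Y i \<le> Y j" "TX i \<le> TX j" "TY i \<le> TY j"
  using assms lift_Suc_mono_le[of X i j] lift_Suc_mono_le[of Y i j]
    lift_Suc_mono_le[of TX i j] lift_Suc_mono_le[of TY i j]
  by (simp_all add: steps)

lemma center_steps: "X n = X (n - 1) + 1" "Y n = Y (n - 1)" "X (Suc n) = X n + 1" "Y (Suc n) = Y n"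
  using steps(1,2)[of "n - 1"] steps(1,2)[of n] L_center n by simp_all

text \<open>Steps to the right after the centre mirror steps up before it. The two central letters x
  have no partner y, which gives n + 1 against n - 1 and makes \<open>r = 1\<close> the starting
  case.\<close>

lemma reflection:
  assumes "1 \<le> r" "r \<le> n"
  shows "X (n + r) + Y (n - r) = int n + 1 \<and> Y (n + r) + X (n - r) = int n - 1"
  using assms
proof (induction r rule: dec_induct)
  case base
  then show ?case
    using center_steps coordinate_sum(1)[of n] by simp
next
  case (step r)
  have "n - r = Suc (n - Suc r)"
    using step by simp
  then have "X (n - r) = X (n - Suc r) + (if L ! (n - Suc r) = Lx then 1 else 0)"
    "Y (n - r) = Y (n - Suc r) + (if L ! (n - Suc r) = Lx then 0 else 1)"
    by (metis steps(1), metis steps(2))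
  moreover have "2 * n - 1 - (n - Suc r) = n + r"
    using step by simp
  then have "L ! (n + r) = swap_letter (L ! (n - Suc r))"
    using L_sym[of "n - Suc r"] step by simp
  ultimately show ?case
    using step steps(1,2)[of "n + r"] by (cases "L ! (n - Suc r)") auto
qed

lemma finish: "X (2 * n) = int n + 1" "Y (2 * n) = int n - 1"
  using reflection[of n] n start by (simp_all add: mult_2)

lemma L_last: "L ! (2 * n - 1) = Lx"
  using L_sym[of 0] L_first n by simp

lemma transposed_vertex:
  assumes "1 \<le> j" "j \<le> 2 * n - 1"
  shows "TX j = 2 * int n + 1 - Y (2 * n - j) \<and> TY j = - X (2 * n - j) - 1"
  using assms
proof (induction j rule: dec_induct)
  case base
  have "2 * n = Suc (2 * n - 1)"
    using n by simp
  then have "X (2 * n) = X (2 * n - 1) + 1" "Y (2 * n) = Y (2 * n - 1)"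
    using steps(1,2)[of "2 * n - 1"] L_last by simp_all
  then show ?case
    using steps(3,4)[of 0] start tL_ends finish by simp
next
  case (step j)
  have "2 * n - j = Suc (2 * n - 1 - j)"
    using step by simp
  then have "X (2 * n - j) = X (2 * n - 1 - j) + (if L ! (2 * n - 1 - j) = Lx then 1 else 0)"
    "Y (2 * n - j) = Y (2 * n - 1 - j) + (if L ! (2 * n - 1 - j) = Lx then 0 else 1)"
    by (metis steps(1), metis steps(2))
  then show ?case
    using step steps(3,4)[of j] tL_nth[of j] by (cases "L ! (2 * n - 1 - j)") auto
qed

text \<open>Transposition followed by reflection about the centre is a translation by (n, -n). So
  the last slice of the modelled quiver lies on the transposed boundary.\<close>

lemma transposed_right:
  assumes "n < j" "j < 2 * n"
  shows "TX j = X j + int n" "TY j = Y j - int n"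
proof -
  have "n + (j - n) = j" "n - (j - n) = 2 * n - j"
    using assms by simp_all
  then have "X j + Y (2 * n - j) = int n + 1" "Y j + X (2 * n - j) = int n - 1"
    using reflection[of "j - n"] assms by simp_all
  moreover have "TX j = 2 * int n + 1 - Y (2 * n - j)" "TY j = - X (2 * n - j) - 1"
    using transposed_vertex[of j] assms by simp_all
  ultimately show "TX j = X j + int n" "TY j = Y j - int n"
    by simp_all
qed

lemma transposed_finish: "TX (2 * n) = 2 * int n" "TY (2 * n) = 0"
proof -
  have "2 * n = Suc (2 * n - 1)" "X (Suc 0) = 0" "Y (Suc 0) = 1" "2 * n - (2 * n - 1) = Suc 0"
    using n start steps(1,2)[of 0] L_first by simp_all
  moreover have "TX (2 * n - 1) = 2 * int n" "TY (2 * n - 1) = - 1"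
    using transposed_vertex[of "2 * n - 1"] n calculation by simp_all
  ultimately show "TX (2 * n) = 2 * int n" "TY (2 * n) = 0"
    using steps(3,4)[of "2 * n - 1"] tL_ends by simp_all
qed

lemma ex_strip_vectors:
  obtains v :: "int \<Rightarrow> 'a \<times> 'a" where "\<And>i. cross (v i) (v (i + 1)) = 1"
    "\<And>i. v (i + (2 * int n + 2)) = - v i"
    "\<And>j. j \<le> 2 * n \<Longrightarrow> cross (v (- Y j - 1)) (v (X j)) = b ! j"
proof -
  have "\<exists>w :: int \<Rightarrow> 'a \<times> 'a.
    (\<forall>i. - Y (2 * n) - 1 \<le> i \<and> i < X (2 * n) \<longrightarrow> cross (w i) (w (i + 1)) = 1) \<and>
    (\<forall>j\<le>2 * n. cross (w (- Y j - 1)) (w (X j)) = b ! j)"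
    by (rule ex_strip[where S = "\<lambda>j. L ! j = Lx"]) (use start steps b_first b_nonzero in auto)
  then obtain w :: "int \<Rightarrow> 'a \<times> 'a" where w: "\<And>i. - int n \<le> i \<Longrightarrow> i < int n + 1 \<Longrightarrow> cross (w i) (w (i + 1)) = 1"
    "\<And>j. j \<le> 2 * n \<Longrightarrow> cross (w (- Y j - 1)) (w (X j)) = b ! j"
    by (auto simp: finish)
  \<comment> \<open>The path from (0, 0) to (n + 1, n - 1) has produced the 2n + 2 vectors of
    indices -n to n + 1, and its final label 1 is the seam condition. This is the origin of the
    period.\<close>
  have "cross (w (- int n)) (w (int n + 1)) = 1"
    using w(2)[of "2 * n"] b_sym[of 0] b_first by (simp add: finish)
  then obtain v where v: "\<And>i. - int n \<le> i \<Longrightarrow> i \<le> int n + 1 \<Longrightarrow> v i = w i"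
    "\<And>i. v (i + (2 * int n + 2)) = - v i" "\<And>i. cross (v i) (v (i + 1)) = 1"
    using antiperiodic_extension[of "2 * int n + 2" "int n + 1" "- int n" w] w(1) by auto
  have "cross (v (- Y j - 1)) (v (X j)) = b ! j" if "j \<le> 2 * n" for j
  proof -
    have "0 \<le> X j" "X j \<le> int n + 1" "0 \<le> Y j" "Y j \<le> int n - 1"
      using mono[OF that] mono[of 0 j] start finish by simp_all
    then show ?thesis using w(2)[OF that] v(1) by simp
  qed
  then show ?thesis using that v by blast
qed

end



section \<open>The values of the strip\<close>

text \<open>
  The scalars carried along a word are the cross products of the two vectors of a vertex with
  a fixed vector \<open>p\<close>.
\<close>

lemma word_step_cross:
  assumes "cross B A = c" "cross B' A' = c'"
    and "if l = Lx then B' = B \<and> cross A A' = 1 else A' = A \<and> cross B' B = 1"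
  shows "word_step l c c' (cross B p) (cross p A) (cross B' p) (cross p A')"
    and "word_step (swap_letter l) c c' (cross p A) (cross B p) (cross p A') (cross B' p)"
  using assms pluecker[of B A p A'] pluecker[of B' p B A]
  by (cases l; simp add: add.commute mult.commute)+

locale strip = symmetric_boundary n L tL b tb
  for n L tL and b tb :: "'a::field list" +
  fixes v :: "int \<Rightarrow> 'a \<times> 'a"
  assumes consecutive: "cross (v i) (v (i + 1)) = 1"
    and antiperiodic: "v (i + (2 * int n + 2)) = - v i"
    and on_path: "j \<le> 2 * n \<Longrightarrow> cross (v (- Y j - 1)) (v (X j)) = b ! j"
begin

definition val :: "int \<Rightarrow> int \<Rightarrow> 'a" where
  "val x y = cross (v (- y - 1)) (v x)"

lemma consecutive': "cross (v (i - 1)) (v i) = 1"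
  using consecutive[of "i - 1"] by simp

lemma val_unimodular: "val x y * val (x + 1) (y - 1) = 1 + val (x + 1) y * val x (y - 1)"
proof -
  have "cross (v (- y - 1)) (v (- y)) = 1"
    using consecutive'[of "- y"] by simp
  then show ?thesis
    using pluecker[of "v (- y - 1)" "v x" "v (- y)" "v (x + 1)"] consecutive[of x]
    by (simp add: val_def algebra_simps)
qed

lemma antiperiodic': "v i = - v (i - (2 * int n + 2))"
  using antiperiodic[of "i - (2 * int n + 2)"] by simp

text \<open>A label of the right half, moved by antiperiodicity, and the equal label of its mirror
  image in the left half are determinants whose two indices both differ by n. So the shift by n
  preserves these determinants.\<close>

lemma reflected_labels:
  assumes "1 \<le> r" "r \<le> n"
  shows "cross (v (X (n + r) - 2 - 2 * int n)) (v (- Y (n + r) - 1)) = b ! (n + r)"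
    and "cross (v (X (n + r) - 2 - int n)) (v (- Y (n + r) - 1 + int n)) = b ! (n + r)"
proof -
  have "cross (v (X (n + r))) (v (- Y (n + r) - 1)) = - b ! (n + r)"
    using on_path[of "n + r"] assms cross_commute[of "v (X (n + r))"] by simp
  then show "cross (v (X (n + r) - 2 - 2 * int n)) (v (- Y (n + r) - 1)) = b ! (n + r)"
    using antiperiodic'[of "X (n + r)"] by (simp add: algebra_simps)
  have index: "X (n + r) - 2 - int n = - Y (n - r) - 1" "- Y (n + r) - 1 + int n = X (n - r)"
    using reflection[OF assms] by simp_all
  have "b ! (n - r) = b ! (n + r)"
    using b_sym[of "n + r"] assms by (simp add: mult_2)
  then show "cross (v (X (n + r) - 2 - int n)) (v (- Y (n + r) - 1 + int n)) = b ! (n + r)"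
    unfolding index using on_path[of "n - r"] by simp
qed

text \<open>
  By the symmetry of the boundary, the shift of the indices by \<open>n\<close> is, on a range of \<open>n + 1\<close>
  consecutive vectors, a linear map.  It is unipotent because the labels around the central
  label 1 are equal, and trace 2 is what the following identity expresses.
\<close>

lemma shift_trace:
  assumes "- Y n - 1 - int n \<le> s" "s < - Y n - 1"
  shows "cross (v s) (v (s + 1 + int n)) + cross (v (s + int n)) (v (s + 1)) = 2"
proof -
  define z where "z = - Y n - 1"
  have Xn: "X n = z + int n + 1"
    using coordinate_sum(1)[of n] by (simp add: z_def)
  define c where "c = b ! (n + 1)"
  have c: "c \<noteq> 0"
    using b_nonzero[of "n + 1"] n by (simp add: c_def)
  let ?A = "v (z - int n)" and ?S = "v z" and ?D = "v (z + int n)"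
  have AS: "cross ?A ?S = c"
    using reflected_labels(1)[of 1] n center_steps Xn by (simp add: c_def z_def algebra_simps)
  have SD: "cross ?S ?D = c"
  proof -
    have "- Y (n - 1) - 1 = z" "X (n - 1) = z + int n"
      using center_steps Xn by (simp_all add: z_def)
    then show ?thesis
      using on_path[of "n - 1"] b_sym[of "n + 1"] n by (simp add: c_def mult_2)
  qed
  have SM: "cross ?S (v (z + int n + 1)) = 1"
    using on_path[of n] b_center Xn by (simp add: z_def)
  \<comment> \<open>The linear map taking \<open>?A\<close> to \<open>?S\<close> and
    \<open>?S\<close> to \<open>?D\<close>, written by Cramer's rule. It has determinant 1 because
    \<open>cross ?A ?S\<close> and \<open>cross ?S ?D\<close> are the same label
    \<open>c\<close>.\<close>
  define g where "g p = ((cross p ?S * fst ?S - cross p ?A * fst ?D) / c,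
    (cross p ?S * snd ?S - cross p ?A * snd ?D) / c)" for p
  have g_left: "cross q (g p) = (cross p ?S * cross q ?S - cross p ?A * cross q ?D) / c" for p q
    using c by (simp add: g_def cross_def field_simps)
  have g_right: "cross (g p) q = (cross p ?S * cross ?S q - cross p ?A * cross ?D q) / c" for p q
    using c by (simp add: g_def cross_def field_simps)
  have g_cross: "cross (g p) (g q) = cross p q" for p q
  proof -
    have "cross (g p) (g q) = (cross p ?A * cross q ?S - cross p ?S * cross q ?A) * cross ?S ?D / c^2"
      using c cross_commute[of ?D ?S] by (simp add: g_left g_right field_simps power2_eq_square)
    also have "cross p ?A * cross q ?S - cross p ?S * cross q ?A = cross ?A ?S * cross p q"
      by (simp add: cross_def algebra_simps)
    finally show ?thesis
      using AS SD c by (simp add: power2_eq_square)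
  qed
  have base: "g ?A = ?S" "g ?S = ?D"
    using AS cross_commute[of ?S ?A] c by (simp_all add: g_def prod_eq_iff)
  \<comment> \<open>The indices on which the shift agrees with \<open>g\<close> form two intervals,
    one growing upwards from \<open>z - int n\<close> and one downwards from \<open>z\<close>.
    Following the path from vertex n + 1 to the right, each letter lengthens one of them by one
    index.\<close>
  have shift: "v (i + int n) = g (v i)"
    if "1 \<le> r" "r \<le> n" "z - int n \<le> i \<and> i \<le> X (n + r) - 2 - 2 * int n \<or> - Y (n + r) - 1 \<le> i \<and> i \<le> z"
    for r i
    using that
  proof (induction r arbitrary: i rule: dec_induct)
    case base
    then have "i = z - int n \<or> i = z"
      using center_steps Xn by (auto simp: z_def)
    then show ?case
      using \<open>g ?A = ?S\<close> \<open>g ?S = ?D\<close> by auto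
  next
    case (step r)
    let ?x = "X (n + r) - 2 - 2 * int n" and ?y = "- Y (n + r) - 1"
    have range: "z - int n \<le> ?x" "?y \<le> z"
      using mono[of "n + 1" "n + r"] step.hyps step.prems(1) center_steps Xn by (simp_all add: z_def)
    have x: "v (?x + int n) = g (v ?x)" and y: "v (?y + int n) = g (v ?y)"
      by (rule step.IH; use range step.prems in simp)+
    have xy: "cross (g (v ?x)) (g (v ?y)) \<noteq> 0"
      using reflected_labels(1)[of r] b_nonzero[of "n + r"] step.hyps step.prems(1) by (simp add: g_cross)
    have new: "cross (v (X (n + Suc r) - 2 - 2 * int n)) (v (- Y (n + Suc r) - 1)) =
      cross (v (X (n + Suc r) - 2 - int n)) (v (- Y (n + Suc r) - 1 + int n))"
      using reflected_labels[of "Suc r"] step.prems(1) by simp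
    show ?case
    proof (cases "L ! (n + r)")
      case Lx
      then have index: "X (n + Suc r) - 2 - 2 * int n = ?x + 1"
        "X (n + Suc r) - 2 - int n = ?x + 1 + int n" "- Y (n + Suc r) - 1 = ?y"
        by (simp_all add: steps)
      \<comment> \<open>The new vector is pinned down by its determinants with its neighbour and
        with the end of the other interval. Both are preserved by the shift, the second by
        \<open>reflected_labels\<close>, and both by \<open>g\<close>.\<close>
      have "v (?x + 1 + int n) = g (v (?x + 1))"
      proof (rule cross_eqI[OF _ _ xy])
        show "cross (g (v ?x)) (v (?x + 1 + int n)) = cross (g (v ?x)) (g (v (?x + 1)))"
          using consecutive[of "?x + int n"] consecutive[of ?x] unfolding g_cross unfolding x[symmetric]
          by (simp add: algebra_simps)
        show "cross (v (?x + 1 + int n)) (g (v ?y)) = cross (g (v (?x + 1))) (g (v ?y))"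
          using new unfolding index g_cross unfolding y[symmetric] by (rule sym)
      qed
      moreover have "v (i + int n) = g (v i)" if "i \<noteq> ?x + 1"
        by (rule step.IH) (use that step.prems Lx in \<open>auto simp: steps\<close>)
      ultimately show ?thesis
        by metis
    next
      case Ly
      then have index: "X (n + Suc r) - 2 - 2 * int n = ?x"
        "X (n + Suc r) - 2 - int n = ?x + int n" "- Y (n + Suc r) - 1 = ?y - 1"
        by (simp_all add: steps)
      have "v (?y - 1 + int n) = g (v (?y - 1))"
      proof (rule cross_eqI[OF _ _ xy])
        show "cross (v (?y - 1 + int n)) (g (v ?y)) = cross (g (v (?y - 1))) (g (v ?y))"
          using consecutive'[of "?y + int n"] consecutive'[of ?y] unfolding g_cross unfolding y[symmetric]
          by (simp add: algebra_simps)
        show "cross (g (v ?x)) (v (?y - 1 + int n)) = cross (g (v ?x)) (g (v (?y - 1)))"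
          using new unfolding index g_cross unfolding x[symmetric] by (rule sym)
      qed
      moreover have "v (i + int n) = g (v i)" if "i \<noteq> ?y - 1"
        by (rule step.IH) (use that step.prems Ly in \<open>auto simp: steps\<close>)
      ultimately show ?thesis
        by metis
    qed
  qed
  \<comment> \<open>At the right end of the path the first interval stops at -n - 1 and the second
    begins at -n, so no index is left out.\<close>
  have shift': "v (i + int n) = g (v i)" if "z - int n \<le> i" "i \<le> z" for i
  proof (rule shift[of n])
    show "1 \<le> n" "n \<le> n"
      using n by simp_all
    show "z - int n \<le> i \<and> i \<le> X (n + n) - 2 - 2 * int n \<or> - Y (n + n) - 1 \<le> i \<and> i \<le> z"
      using that finish[unfolded mult_2] by linarith
  qed
  have gs: "v (s + int n) = g (v s)" "v (s + 1 + int n) = g (v (s + 1))"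
    using shift'[of s] shift'[of "s + 1"] assms by (simp_all add: z_def)
  \<comment> \<open>The central label 1 enters here, as \<open>cross ?S ?M\<close>. Antiperiodicity
    makes \<open>- ?A\<close> the successor of \<open>?M\<close>, so the two terms of the Pluecker
    relation are equal.\<close>
  have AD: "cross ?A ?D = 2 * c"
  proof -
    let ?M = "v (z + int n + 1)" and ?E = "v (z + int n + 2)"
    have E: "?E = - ?A"
      using antiperiodic[of "z - int n"] by (simp add: algebra_simps)
    have "cross ?D ?M = 1" "cross ?M ?E = 1"
      using consecutive[of "z + int n"] consecutive[of "z + int n + 1"] by (simp_all add: algebra_simps)
    then have "cross ?A ?M = 1" "cross ?M ?D = - 1"
      using cross_commute[of ?A ?M] cross_commute[of ?M ?D] E by simp_all
    moreover have "cross ?S ?A = - c"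
      using AS cross_commute[of ?S ?A] by simp
    ultimately have "cross ?A ?D = c + c"
      using pluecker[of ?S ?M ?A ?D] SM SD by simp
    then show ?thesis
      by simp
  qed
  \<comment> \<open>For every linear map of the plane the left side is its trace times
    \<open>cross p q\<close>; for \<open>g\<close> the trace is
    \<open>cross ?A ?D / c\<close>.\<close>
  have trace: "cross p (g q) + cross (g p) q = 2 * cross p q" for p q
  proof -
    have "cross p (g q) + cross (g p) q =
      (cross q ?S * cross p ?S + cross p ?S * cross ?S q
        - (cross q ?A * cross p ?D + cross p ?A * cross ?D q)) / c"
      by (simp add: g_left g_right diff_divide_distrib add_divide_distrib)
    also have "\<dots> = cross ?A ?D * cross p q / c"
      by (simp add: cross_def algebra_simps)
    finally show ?thesis
      using c by (simp add: AD)
  qed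
  show ?thesis
    using trace[of "v s" "v (s + 1)"] consecutive[of s] by (simp add: gs)
qed

text \<open>The two points are the remaining corners of the mesh of vertex n + 1 between the levels
  \<open>k\<close> and \<open>k + 1\<close>, one in the central row and one in row n + 2.
  Antiperiodicity brings them to the indices of \<open>shift_trace\<close>, where the range of
  \<open>s\<close> is exactly the range of \<open>k\<close>.\<close>

lemma val_transvection:
  assumes "0 \<le> k" "k < int n"
  shows "val (X n + k + 1) (Y n - k - 1) = val (X n + k + 2) (Y n - k) + 2"
proof -
  define s where "s = - Y n - 1 - int n + k"
  have Xn: "X n = int n - Y n"
    using coordinate_sum(1)[of n] by simp
  have "v (X n + k + 1) = - v s" "v (X n + k + 2) = - v (s + 1)"
    using antiperiodic[of s] antiperiodic[of "s + 1"] by (simp_all add: s_def Xn algebra_simps)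
  moreover have "- (Y n - k - 1) - 1 = s + 1 + int n" "- (Y n - k) - 1 = s + int n"
    by (simp_all add: s_def)
  ultimately have "val (X n + k + 1) (Y n - k - 1) = cross (v (s + 1 + int n)) (- v s)"
    "val (X n + k + 2) (Y n - k) = cross (v (s + int n)) (- v (s + 1))"
    by (simp_all only: val_def)
  then have "val (X n + k + 1) (Y n - k - 1) = cross (v s) (v (s + 1 + int n))"
    "val (X n + k + 2) (Y n - k) = - cross (v (s + int n)) (v (s + 1))"
    using cross_commute[of "v s"] by simp_all
  then show ?thesis
    using shift_trace[of s] assms by (simp add: s_def add_eq_0_iff eq_diff_eq flip: diff_eq_eq)
qed

lemma word_step_L:
  assumes "r < 2 * n"
  shows "word_step (L ! r) (b ! r) (b ! Suc r)
    (cross (v (- Y r - 1)) p) (cross p (v (X r)))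
    (cross (v (- Y (Suc r) - 1)) p) (cross p (v (X (Suc r))))"
proof (rule word_step_cross(1))
  show "cross (v (- Y r - 1)) (v (X r)) = b ! r"
    "cross (v (- Y (Suc r) - 1)) (v (X (Suc r))) = b ! Suc r"
    using on_path assms by simp_all
  show "if L ! r = Lx
    then v (- Y (Suc r) - 1) = v (- Y r - 1) \<and> cross (v (X r)) (v (X (Suc r))) = 1
    else v (X (Suc r)) = v (X r) \<and> cross (v (- Y (Suc r) - 1)) (v (- Y r - 1)) = 1"
  proof (cases "L ! r = Lx")
    case True
    then show ?thesis
      using consecutive[of "X r"] by (simp add: steps)
  next
    case False
    then have "- Y (Suc r) - 1 = - Y r - 1 - 1" "X (Suc r) = X r"
      by (simp_all add: steps)
    then show ?thesis
      using False consecutive'[of "- Y r - 1"] by (simp only: if_False simp_thms)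
  qed
qed

text \<open>Transposition exchanges the two vectors of a vertex, up to a period. The sign from the
  exchange and the sign from the period cancel, so the transposed boundary carries its labels in the
  same strip.\<close>

lemma transposed_labels:
  assumes "j \<le> 2 * n"
  shows "cross (v (- TY j - 1)) (v (TX j)) = tb ! j"
proof -
  consider "j = 0" | "j = 2 * n" | "1 \<le> j" "j \<le> 2 * n - 1"
    using assms by linarith
  then show ?thesis
  proof cases
    case 1
    then show ?thesis
      using consecutive[of "int n"] b_first by (simp add: start tb_nth)
  next
    case 2
    have "v (- 1) = - v (2 * int n + 1)"
      using antiperiodic'[of "2 * int n + 1"] by simp
    then have "cross (v (- 1)) (v (2 * int n)) = 1"
      using consecutive[of "2 * int n"] cross_commute[of "v (2 * int n + 1)"] by simp
    then show ?thesis
      using 2 b_sym[of 0] b_first by (simp add: transposed_finish tb_nth)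
  next
    case 3
    let ?x = "X (2 * n - j)" and ?y = "Y (2 * n - j)"
    have "2 * int n + 1 - ?y - (2 * int n + 2) = - ?y - 1"
      by simp
    then have "v (2 * int n + 1 - ?y) = - v (- ?y - 1)"
      using antiperiodic'[of "2 * int n + 1 - ?y"] by (simp only:)
    then have "cross (v ?x) (v (2 * int n + 1 - ?y)) = b ! j"
      using on_path[of "2 * n - j"] b_sym[of j] assms cross_commute[of "v ?x"] by simp
    then show ?thesis
      using transposed_vertex[OF 3] assms by (simp add: tb_nth)
  qed
qed

text \<open>On the transposed boundary a word starts at the vertical projection, so the fixed vector
  belongs to a column instead of a row and the components \<open>e\<close> and \<open>g\<close>
  change places. This is why the letters of such a word are interchanged.\<close>

lemma word_step_tL:
  assumes "r < 2 * n"
  shows "word_step (swap_letter (tL ! r)) (tb ! r) (tb ! Suc r)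
    (cross p (v (TX r))) (cross (v (- TY r - 1)) p)
    (cross p (v (TX (Suc r)))) (cross (v (- TY (Suc r) - 1)) p)"
proof (rule word_step_cross(2))
  show "cross (v (- TY r - 1)) (v (TX r)) = tb ! r"
    "cross (v (- TY (Suc r) - 1)) (v (TX (Suc r))) = tb ! Suc r"
    using transposed_labels assms by simp_all
  show "if tL ! r = Lx
    then v (- TY (Suc r) - 1) = v (- TY r - 1) \<and> cross (v (TX r)) (v (TX (Suc r))) = 1
    else v (TX (Suc r)) = v (TX r) \<and> cross (v (- TY (Suc r) - 1)) (v (- TY r - 1)) = 1"
  proof (cases "tL ! r = Lx")
    case True
    then show ?thesis
      using consecutive[of "TX r"] by (simp add: steps)
  next
    case False
    then have "- TY (Suc r) - 1 = - TY r - 1 - 1" "TX (Suc r) = TX r"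
      by (simp_all add: steps)
    then show ?thesis
      using False consecutive'[of "- TY r - 1"] by (simp only: if_False simp_thms)
  qed
qed

lemma word_on_path:
  assumes ij: "i + 2 \<le> j" "j \<le> 2 * n" and first: "L ! i = Ly"
  defines "w \<equiv> portion (b, L) i j"
  shows "L ! (j - 1) = Lx \<Longrightarrow> word_formula w (vector [1, fst w ! (word_m w + 1)]) = val (X j) (Y i)"
    and "L ! (j - 1) = Ly \<Longrightarrow> word_formula w (vector [fst w ! (word_m w + 1), 1]) =
      cross (v (- Y j - 1)) (v (- Y i - 1))"
proof -
  \<comment> \<open>Fixing the vector attached to the row of vertex \<open>i\<close> makes
    \<open>e\<close> start at 0 and \<open>g\<close> at the label \<open>b ! i\<close>, the initial
    pair of \<open>portion_formula\<close>.\<close>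
  define e g where "e r = cross (v (- Y r - 1)) (v (- Y i - 1))"
    and "g r = cross (v (- Y i - 1)) (v (X r))" for r
  have "j < length b" "j \<le> length L" "\<And>r. r < length b \<Longrightarrow> b ! r \<noteq> 0"
    using ij b_nonzero by (simp_all add: length_L length_b)
  moreover have "e i = 0" "g i = b ! i"
    using on_path[of i] ij by (simp_all add: e_def g_def)
  moreover have "word_step (L ! r) (b ! r) (b ! Suc r) (e r) (g r) (e (Suc r)) (g (Suc r))"
    if "i \<le> r" "r < j" for r
    unfolding e_def g_def by (rule word_step_L) (use that ij in simp)
  ultimately have
    "L ! (j - 1) = Lx \<Longrightarrow> word_formula w (vector [1, fst w ! (word_m w + 1)]) = g j"
    "L ! (j - 1) = Ly \<Longrightarrow> word_formula w (vector [fst w ! (word_m w + 1), 1]) = e j"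
    using portion_formula[where w = w and xs = L and bs = b and i = i and j = j and e = e and g = g]
      ij(1) first w_def by blast+
  then show "L ! (j - 1) = Lx \<Longrightarrow> word_formula w (vector [1, fst w ! (word_m w + 1)]) = val (X j) (Y i)"
    and "L ! (j - 1) = Ly \<Longrightarrow> word_formula w (vector [fst w ! (word_m w + 1), 1]) =
      cross (v (- Y j - 1)) (v (- Y i - 1))"
    by (simp_all only: val_def e_def g_def)
qed

lemma word_on_transposed_path:
  assumes ij: "i + 2 \<le> j" "j \<le> 2 * n" and letters: "tL ! i = Lx" "tL ! (j - 1) = Ly"
  defines "w \<equiv> swap_letters (portion (tb, tL) i j)"
  shows "word_formula w (vector [1, fst w ! (word_m w + 1)]) = val (TX i) (TY j)"
proof -
  define e g where "e r = cross (v (TX i)) (v (TX r))"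
    and "g r = cross (v (- TY r - 1)) (v (TX i))" for r
  have "j < length tb" "j \<le> length (map swap_letter tL)" "\<And>r. r < length tb \<Longrightarrow> tb ! r \<noteq> 0"
    using ij b_nonzero by (simp_all add: length_tL length_tb tb_nth)
  moreover have "e i = 0" "g i = tb ! i"
    using transposed_labels[of i] ij by (simp_all add: e_def g_def)
  moreover have nth: "map swap_letter tL ! r = swap_letter (tL ! r)" if "r < j" for r
    using that ij by (simp add: length_tL)
  moreover have "word_step (map swap_letter tL ! r) (tb ! r) (tb ! Suc r)
      (e r) (g r) (e (Suc r)) (g (Suc r))" if "i \<le> r" "r < j" for r
    unfolding e_def g_def nth[OF that(2)] by (rule word_step_tL) (use that ij in simp)
  moreover have "map swap_letter tL ! i = Ly" "map swap_letter tL ! (j - 1) = Lx"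
    using nth[of i] nth[of "j - 1"] ij letters by simp_all
  moreover have "w = portion (tb, map swap_letter tL) i j"
    by (simp add: w_def swap_letters_portion)
  ultimately have "word_formula w (vector [1, fst w ! (word_m w + 1)]) = g j"
    using portion_formula_Lx[where w = w and xs = "map swap_letter tL" and bs = tb
        and i = i and j = j and e = e and g = g] ij(1) by blast
  then show ?thesis
    by (simp only: val_def g_def)
qed

end



section \<open>Projections of a point onto the two boundary paths\<close>

context symmetric_boundary
begin

definition "hF x y = is_arg_min (\<lambda>i. x - X i) (\<lambda>i. i \<le> 2 * n \<and> Y i = y \<and> X i < x)"
definition "vF x y = is_arg_min (\<lambda>i. Y i - y) (\<lambda>i. i \<le> 2 * n \<and> X i = x \<and> y < Y i)"
definition "hT x y = is_arg_min (\<lambda>i. TX i - x) (\<lambda>i. i \<le> 2 * n \<and> TY i = y \<and> x < TX i)"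
definition "vT x y = is_arg_min (\<lambda>i. y - TY i) (\<lambda>i. i \<le> 2 * n \<and> TX i = x \<and> TY i < y)"

definition off_boundary :: "int \<Rightarrow> int \<Rightarrow> bool" where
  "off_boundary x y \<longleftrightarrow> (\<forall>i\<le>2 * n. (X i, Y i) \<noteq> (x, y) \<and> (TX i, TY i) \<noteq> (x, y))"

text \<open>If the nearest vertex were followed by x, the next vertex would lie in the same row and
  be nearer, and it is not the point itself off the boundary. The letters forced in this way at the
  projections are the end letters that \<open>portion_formula\<close> asks for.\<close>

lemma hF_props:
  assumes "off_boundary x y" "hF x y i"
  shows "i \<le> 2 * n" "Y i = y" "X i < x" "i < 2 * n \<Longrightarrow> L ! i = Ly"
proof -
  show i: "i \<le> 2 * n" "Y i = y" "X i < x"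
    using assms(2) by (auto simp: hF_def is_arg_min_def)
  show "L ! i = Ly" if "i < 2 * n"
  proof (rule ccontr)
    assume "L ! i \<noteq> Ly"
    then have s: "X (Suc i) = X i + 1" "Y (Suc i) = y"
      using i by (auto simp: steps letter_not_Lx)
    have "X (Suc i) \<noteq> x"
      using assms(1) that s(2) unfolding off_boundary_def by (metis Suc_leI)
    then have "Suc i \<le> 2 * n \<and> Y (Suc i) = y \<and> X (Suc i) < x \<and> x - X (Suc i) < x - X i"
      using s i that by simp
    then show False
      using assms(2) unfolding hF_def is_arg_min_def by blast
  qed
qed

lemma vF_props:
  assumes "off_boundary x y" "vF x y j"
  shows "j \<le> 2 * n" "X j = x" "y < Y j" "0 < j \<Longrightarrow> L ! (j - 1) = Lx"
proof -
  show j: "j \<le> 2 * n" "X j = x" "y < Y j"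
    using assms(2) by (auto simp: vF_def is_arg_min_def)
  show "L ! (j - 1) = Lx" if "0 < j"
  proof (rule ccontr)
    assume "L ! (j - 1) \<noteq> Lx"
    then have s: "X (j - 1) = x" "Y (j - 1) = Y j - 1"
      using j steps(1,2)[of "j - 1"] that by simp_all
    have "Y (j - 1) \<noteq> y"
      using assms(1) j(1) s(1) unfolding off_boundary_def by (metis diff_le_self le_trans)
    then have "j - 1 \<le> 2 * n \<and> X (j - 1) = x \<and> y < Y (j - 1) \<and> Y (j - 1) - y < Y j - y"
      using s j by simp
    then show False
      using assms(2) unfolding vF_def is_arg_min_def by blast
  qed
qed

lemma hT_props:
  assumes "off_boundary x y" "hT x y j"
  shows "j \<le> 2 * n" "TY j = y" "x < TX j" "0 < j \<Longrightarrow> tL ! (j - 1) = Ly"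
proof -
  show j: "j \<le> 2 * n" "TY j = y" "x < TX j"
    using assms(2) by (auto simp: hT_def is_arg_min_def)
  show "tL ! (j - 1) = Ly" if "0 < j"
  proof (rule ccontr)
    assume "tL ! (j - 1) \<noteq> Ly"
    then have s: "TY (j - 1) = y" "TX (j - 1) = TX j - 1"
      using j steps(3,4)[of "j - 1"] that by (auto simp: letter_not_Lx)
    have "TX (j - 1) \<noteq> x"
      using assms(1) j(1) s(1) unfolding off_boundary_def by (metis diff_le_self le_trans)
    then have "j - 1 \<le> 2 * n \<and> TY (j - 1) = y \<and> x < TX (j - 1) \<and> TX (j - 1) - x < TX j - x"
      using s j by simp
    then show False
      using assms(2) unfolding hT_def is_arg_min_def by blast
  qed
qed

lemma vT_props:
  assumes "off_boundary x y" "vT x y i"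
  shows "i \<le> 2 * n" "TX i = x" "TY i < y" "i < 2 * n \<Longrightarrow> tL ! i = Lx"
proof -
  show i: "i \<le> 2 * n" "TX i = x" "TY i < y"
    using assms(2) by (auto simp: vT_def is_arg_min_def)
  show "tL ! i = Lx" if "i < 2 * n"
  proof (rule ccontr)
    assume "tL ! i \<noteq> Lx"
    then have s: "TX (Suc i) = x" "TY (Suc i) = TY i + 1"
      using i by (simp_all add: steps)
    have "TY (Suc i) \<noteq> y"
      using assms(1) that s(1) unfolding off_boundary_def by (metis Suc_leI)
    then have "Suc i \<le> 2 * n \<and> TX (Suc i) = x \<and> TY (Suc i) < y \<and> y - TY (Suc i) < y - TY i"
      using s i that by simp
    then show False
      using assms(2) unfolding vT_def is_arg_min_def by blast
  qed
qed

lemma ex_min_index: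
  fixes f :: "nat \<Rightarrow> int"
  assumes "i \<le> 2 * n" "P i"
  shows "\<exists>j. is_arg_min f (\<lambda>j. j \<le> 2 * n \<and> P j) j"
proof -
  have "\<exists>j. is_arg_min f (\<lambda>j. j \<in> {j. j \<le> 2 * n \<and> P j}) j"
    by (rule ex_is_arg_min_if_finite) (use assms in auto)
  then show ?thesis
    by simp
qed

lemma index_at_height:
  fixes f :: "nat \<Rightarrow> int"
  assumes "\<And>i. \<bar>f (Suc i) - f i\<bar> \<le> 1" "i \<le> j" "f i \<le> c" "c \<le> f j"
  obtains l where "i \<le> l" "l \<le> j" "f l = c"
  using nat_intermed_int_val[of i j f c] assms by auto

text \<open>Discrete intermediate values: coordinates change by at most one per step, and vertex
  \<open>s\<close>, moved by (k, -k), lies strictly between its positions on the two paths. Each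
  path is followed from the vertex \<open>s\<close> towards the end at which the required row or
  column is reached.\<close>

lemma ex_projections:
  assumes s: "n < s" "s < 2 * n" and k: "0 < k" "k < int n"
  defines "x \<equiv> X s + k" and "y \<equiv> Y s - k"
  shows "0 \<le> y \<Longrightarrow> \<exists>i. hF x y i"
    and "x \<le> int n + 1 \<Longrightarrow> \<exists>i. vF x y i"
    and "y \<le> 0 \<Longrightarrow> \<exists>i. hT x y i"
    and "int n + 2 \<le> x \<Longrightarrow> \<exists>i. vT x y i"
proof -
  have lip: "\<bar>X (Suc i) - X i\<bar> \<le> 1" "\<bar>Y (Suc i) - Y i\<bar> \<le> 1"
    "\<bar>TX (Suc i) - TX i\<bar> \<le> 1" "\<bar>TY (Suc i) - TY i\<bar> \<le> 1" for i
    by (simp_all add: steps)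
  show "\<exists>i. hF x y i" if le: "0 \<le> y"
  proof -
    obtain i where "i \<le> s" "Y i = y"
      by (rule index_at_height[of Y 0 s y]) (use lip start le k in \<open>auto simp: y_def\<close>)
    then show ?thesis
      unfolding hF_def using mono(1)[of i s] s k by (intro ex_min_index[of i]) (auto simp: x_def)
  qed
  show "\<exists>i. vF x y i" if le: "x \<le> int n + 1"
  proof -
    obtain i where "s \<le> i" "i \<le> 2 * n" "X i = x"
      by (rule index_at_height[of X s "2 * n" x]) (use lip finish le k s in \<open>auto simp: x_def\<close>)
    then show ?thesis
      unfolding vF_def using mono(2)[of s i] s k by (intro ex_min_index[of i]) (auto simp: y_def)
  qed
  show "\<exists>i. hT x y i" if le: "y \<le> 0"
  proof -
    obtain i where "s \<le> i" "i \<le> 2 * n" "TY i = y"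
      by (rule index_at_height[of TY s "2 * n" y])
        (use lip transposed_finish transposed_right[OF s] le k s in \<open>auto simp: y_def\<close>)
    then show ?thesis
      unfolding hT_def using mono(3)[of s i] transposed_right[OF s] k
      by (intro ex_min_index[of i]) (auto simp: x_def)
  qed
  show "\<exists>i. vT x y i" if le: "int n + 2 \<le> x"
  proof -
    obtain i where "i \<le> s" "TX i = x"
      by (rule index_at_height[of TX 0 s x])
        (use lip start transposed_right[OF s] le k in \<open>auto simp: x_def\<close>)
    then show ?thesis
      unfolding vT_def using mono(4)[of i s] transposed_right[OF s] s k
      by (intro ex_min_index[of i]) (auto simp: y_def)
  qed
qed

lemma on_boundary_ends:
  assumes "n < s" "s < 2 * n" "k = 0 \<or> k = int n"
  shows "\<not> off_boundary (X s + k) (Y s - k)"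
  using assms transposed_right[of s] unfolding off_boundary_def by (auto intro!: exI[of _ s])

end

section \<open>The three kinds of words evaluated\<close>

context strip
begin

lemma same_word_on_F:
  assumes "off_boundary x y" "hF x y i" "vF x y j"
  defines "w \<equiv> portion (b, L) i j"
  shows "1 \<le> word_m w" "word_formula w (vector [1, fst w ! (word_m w + 1)]) = val x y"
proof -
  note i = hF_props[OF assms(1,2)] and j = vF_props[OF assms(1,3)]
  \<comment> \<open>Both coordinates increase strictly from the horizontal to the vertical
    projection, and their sum is the index on the path.\<close>
  have ij: "i + 2 \<le> j"
    using i(2,3) j(2,3) coordinate_sum(1)[of i] coordinate_sum(1)[of j] by linarith
  then show "1 \<le> word_m w"
    using j(1) by (simp add: w_def word_m_portion length_L length_b)
  have "L ! i = Ly" "L ! (j - 1) = Lx"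
    using i(4) j(1,4) ij by simp_all
  then show "word_formula w (vector [1, fst w ! (word_m w + 1)]) = val x y"
    using word_on_path(1)[of i j] ij i(2) j(1,2) by (simp add: w_def)
qed

lemma same_word_on_tF:
  assumes "off_boundary x y" "vT x y i" "hT x y j"
  defines "w \<equiv> swap_letters (portion (tb, tL) i j)"
  shows "1 \<le> word_m w" "word_formula w (vector [1, fst w ! (word_m w + 1)]) = val x y"
proof -
  note i = vT_props[OF assms(1,2)] and j = hT_props[OF assms(1,3)]
  have ij: "i + 2 \<le> j"
    using i(2,3) j(2,3) coordinate_sum(2)[of i] coordinate_sum(2)[of j] by linarith
  then show "1 \<le> word_m w"
    using j(1) by (simp add: w_def swap_letters_portion word_m_portion length_tL length_tb)
  have "tL ! i = Lx" "tL ! (j - 1) = Ly"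
    using i(4) j(1,4) ij by simp_all
  then show "word_formula w (vector [1, fst w ! (word_m w + 1)]) = val x y"
    using word_on_transposed_path[of i j] ij i(2) j(1,2) by (simp add: w_def)
qed

text \<open>The word ends at a vertex of F whose row vector, by transposition, has index
  \<open>x - (2 * int n + 2)\<close>. The formula gives the determinant of two row vectors, and
  antiperiodicity turns the first of them into the column vector \<open>v x\<close>.\<close>

lemma mixed_word_value:
  assumes "off_boundary x y" "hF x y i" "vT x y j"
    and bounds: "int n + 2 \<le> x" "x \<le> 2 * int n - 1" "x + y \<le> 2 * int n - 1"
  defines "w \<equiv> portion (b, L) i (2 * n - j)"
  shows "1 \<le> word_m w" "word_formula w (vector [fst w ! (word_m w + 1), 1]) = val x y"
proof -
  note i = hF_props[OF assms(1,2)] and j = vT_props[OF assms(1,3)]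
  have "j \<noteq> 0" "j \<noteq> 2 * n"
    using j(2) bounds start(3) transposed_finish(1) by (cases j; force)+
  moreover have "TX (2 * n) = TX (2 * n - 1)"
    using steps(3)[of "2 * n - 1"] tL_ends(2) n by simp
  \<comment> \<open>The last two vertices of the transposed boundary both have abscissa 2n, which
    the bound on \<open>x\<close> excludes.\<close>
  then have "j \<noteq> 2 * n - 1"
    using j(2) bounds(2) transposed_finish(1) by auto
  ultimately have j': "1 \<le> j" "j \<le> 2 * n - 2" "j < 2 * n"
    using j(1) by auto
  define J where "J = 2 * n - j"
  have YJ: "Y J = 2 * int n + 1 - x"
    using transposed_vertex[of j] j' j(2) by (simp add: J_def)
  \<comment> \<open>A smaller \<open>J\<close> would have height at most \<open>y + 1\<close>, which
    forces \<open>x + y \<ge> 2 * int n\<close>, outside the strip.\<close>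
  have ij: "i + 2 \<le> J"
  proof (rule ccontr)
    assume "\<not> ?thesis"
    then have "Y J \<le> Y (Suc i)"
      by (intro mono) simp
    also have "\<dots> \<le> y + 1"
      using i(2) by (simp add: steps)
    finally show False
      using YJ bounds by simp
  qed
  then show "1 \<le> word_m w"
    unfolding w_def J_def[symmetric]
    by (subst word_m_portion) (simp_all add: J_def length_L length_b)
  have "L ! (J - 1) = Ly"
    using tL_nth[of j] j(4) j' by (cases "L ! (2 * n - 1 - j)") (simp_all add: J_def)
  moreover have "L ! i = Ly" "J \<le> 2 * n"
    using i(4) ij by (simp_all add: J_def)
  ultimately have "word_formula w (vector [fst w ! (word_m w + 1), 1]) = cross (v (- Y J - 1)) (v (- y - 1))"
    using word_on_path(2)[of i J] ij i(2) by (simp add: w_def flip: J_def)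
  also have "- Y J - 1 = x - (2 * int n + 2)"
    using YJ by simp
  also have "cross (v (x - (2 * int n + 2))) (v (- y - 1)) = val x y"
    using antiperiodic'[of x] cross_commute[of "v (- y - 1)" "v x"] by (simp add: val_def)
  finally show "word_formula w (vector [fst w ! (word_m w + 1), 1]) = val x y" .
qed

end



section \<open>Friezes on the strip\<close>

context strip
begin

definition T :: "int \<Rightarrow> nat \<Rightarrow> 'a" where
  "T k j = val (X j + k) (Y j - k)"

text \<open>The level at which the neighbour j + 1 occurs in the mesh from (k, j) to (k + 1, j): the
  current one if the arrow leaves j, the next one if it enters j. \<open>left_level\<close> is the
  same for j - 1.\<close>

definition right_level :: "int \<Rightarrow> nat \<Rightarrow> int" where
  "right_level k j = (if L ! j = Lx then k else k + 1)"

definition left_level :: "int \<Rightarrow> nat \<Rightarrow> int" where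
  "left_level k j = (if L ! (j - 1) = Lx then k + 1 else k)"

lemma T_frieze:
  assumes "0 < j"
  shows "T k j * T (k + 1) j = 1 + T (right_level k j) (Suc j) * T (left_level k j) (j - 1)"
proof -
  have "T (right_level k j) (Suc j) = val (X j + k + 1) (Y j - k)"
    by (simp add: T_def right_level_def steps algebra_simps)
  moreover have "T (left_level k j) (j - 1) = val (X j + k) (Y j - k - 1)"
    using steps(1,2)[of "j - 1"] assms by (simp add: T_def left_level_def algebra_simps)
  ultimately show ?thesis
    using val_unimodular[of "X j + k" "Y j - k"] by (simp add: T_def algebra_simps)
qed

lemma T_ends: "T k 0 = 1" "T k (2 * n) = 1"
proof -
  show "T k 0 = 1"
    using consecutive'[of k] by (simp add: T_def val_def start)
  have "v (k - int n) = - v (int n + 1 + k + 1)"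
    using antiperiodic[of "k - int n"] by (simp add: algebra_simps)
  then show "T k (2 * n) = 1"
    using consecutive[of "int n + 1 + k"] cross_commute[of "v (int n + 1 + k + 1)"]
    by (simp add: T_def val_def finish)
qed

lemma T_0: "j \<le> 2 * n \<Longrightarrow> T 0 j = b ! j"
  using on_path[of j] by (simp add: T_def val_def)

lemma T_transvection:
  assumes "0 \<le> k" "k < int n"
  shows "T (k + 1) n = T (right_level k (Suc n)) (Suc (Suc n)) + 2"
proof -
  have "T (right_level k (Suc n)) (Suc (Suc n)) = val (X n + k + 2) (Y n - k)"
    using center_steps(3,4) steps(1,2)[of "Suc n"] by (simp add: T_def right_level_def algebra_simps)
  then show ?thesis
    using val_transvection[OF assms] by (simp add: T_def algebra_simps)
qed

text \<open>Apart from the shift by n, this is x - y at the point of (k, j), which rises by one at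
  each arrow of the mesh. The shift keeps the argument of \<open>nat\<close> positive on the
  boundary, where the ordinates are at most n - 1.\<close>

definition weight :: "int \<Rightarrow> nat \<Rightarrow> nat" where
  "weight k j = nat (X j - Y j + 2 * k + int n)"

lemma weight_less:
  assumes "0 < j" "j < 2 * n" "0 \<le> k"
  shows "weight (right_level k j) (Suc j) < weight (k + 1) j"
    and "weight (left_level k j) (j - 1) < weight (k + 1) j"
    and "weight k j < weight (k + 1) j"
proof -
  have "0 \<le> X j" "Y j \<le> int n - 1"
    using mono(1)[of 0 j] mono(2)[of j "2 * n"] assms finish start by simp_all
  then show "weight (right_level k j) (Suc j) < weight (k + 1) j"
    "weight (left_level k j) (j - 1) < weight (k + 1) j" "weight k j < weight (k + 1) j"
    using assms(1,3) steps(1,2)[of "j - 1"] steps(1,2)[of j]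
    by (auto simp: weight_def right_level_def left_level_def)
qed

lemma right_level_bounds: "k \<le> right_level k j" "right_level k j \<le> k + 1"
  and left_level_bounds: "k \<le> left_level k j" "left_level k j \<le> k + 1"
  by (simp_all add: right_level_def left_level_def)

text \<open>Equality and membership in \<open>C\<close> go through one induction: membership of the
  value one level below makes it a legitimate divisor, and only then does the relation determine the
  next value.\<close>

lemma frieze_eq_T:
  fixes C :: "'a set"
  assumes C: "0 \<notin> C" "1 \<in> C" "\<And>p q. p \<in> C \<Longrightarrow> q \<in> C \<Longrightarrow> p + q \<in> C"
      "\<And>p q. p \<in> C \<Longrightarrow> q \<in> C \<Longrightarrow> p * q \<in> C" "\<And>p q. p \<in> C \<Longrightarrow> q \<in> C \<Longrightarrow> p / q \<in> C"
    and b: "\<And>j. j \<le> 2 * n \<Longrightarrow> b ! j \<in> C"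
    and init: "\<And>j. 0 < j \<Longrightarrow> j < 2 * n \<Longrightarrow> f (0, j) = b ! j"
    and frieze: "\<And>k j. 0 < j \<Longrightarrow> j < 2 * n \<Longrightarrow> f (k, j) * f (k + 1, j) =
      1 + (if Suc j = 2 * n then 1 else f (right_level k j, Suc j)) *
        (if j = 1 then 1 else f (left_level k j, j - 1))"
    and kj: "0 \<le> k" "0 < j" "j < 2 * n"
  shows "f (k, j) = T k j \<and> T k j \<in> C"
  using kj
proof (induction "weight k j" arbitrary: k j rule: less_induct)
  case less
  show ?case
  proof (cases "k = 0")
    case True
    then show ?thesis
      using less.prems init b T_0 by simp
  next
    case False
    define l where "l = k - 1"
    have l: "k = l + 1" "0 \<le> l"
      using False less.prems by (simp_all add: l_def)
    note lessw = weight_less[OF less.prems(2,3) l(2)]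
    have here: "f (l, j) = T l j" "T l j \<in> C"
      using less.hyps[of l j] lessw(3) l less.prems by simp_all
    let ?r = "right_level l j" and ?s = "left_level l j"
    have right: "(if Suc j = 2 * n then 1 else f (?r, Suc j)) = T ?r (Suc j) \<and> T ?r (Suc j) \<in> C"
      using less.hyps[of ?r "Suc j"] lessw(1) l less.prems right_level_bounds(1)[of l j] T_ends(2)[of ?r] C(2)
      by (cases "Suc j = 2 * n") auto
    have left: "(if j = 1 then 1 else f (?s, j - 1)) = T ?s (j - 1) \<and> T ?s (j - 1) \<in> C"
      using less.hyps[of ?s "j - 1"] lessw(2) l less.prems left_level_bounds(1)[of l j] T_ends(1)[of ?s] C(2)
      by (cases "j = 1") auto
    have "T l j * f (k, j) = 1 + T ?r (Suc j) * T ?s (j - 1)"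
      using frieze[of j l] here right left less.prems l(1) by simp
    moreover have "T l j * T k j = 1 + T ?r (Suc j) * T ?s (j - 1)"
      using T_frieze[of j l] less.prems l(1) by simp
    moreover have "T l j \<noteq> 0"
      using here(2) C(1) by auto
    moreover have "1 + T ?r (Suc j) * T ?s (j - 1) \<in> C"
      using right left C(2-4) by simp
    then have "(1 + T ?r (Suc j) * T ?s (j - 1)) / T l j \<in> C"
      using here(2) C(5) by simp
    ultimately show ?thesis
      by (metis mult_left_cancel nonzero_mult_div_cancel_left)
  qed
qed

text \<open>The same recursion on the right half. In row n + 1 the squared relation takes the place
  of a relation with the central row, and the upper bound on the level is the one under which
  \<open>T_transvection\<close> applies.\<close>

lemma modelled_eq_T:
  assumes n3: "3 \<le> n"
    and nz: "\<And>k j. 0 \<le> k \<Longrightarrow> 0 < j \<Longrightarrow> j < 2 * n \<Longrightarrow> T k j \<noteq> 0"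
    and init: "\<And>j. n < j \<Longrightarrow> j < 2 * n \<Longrightarrow> f (0, j) = b ! j"
    and joint: "\<And>k. f (k, Suc n) * f (k + 1, Suc n) = (1 + f (right_level k (Suc n), Suc (Suc n)))^2"
    and frieze: "\<And>k j. Suc n < j \<Longrightarrow> j < 2 * n \<Longrightarrow> f (k, j) * f (k + 1, j) =
      1 + (if Suc j = 2 * n then 1 else f (right_level k j, Suc j)) * f (left_level k j, j - 1)"
    and kj: "0 \<le> k" "k \<le> int n" "n < j" "j < 2 * n"
  shows "f (k, j) = T k j"
  using kj
proof (induction "weight k j" arbitrary: k j rule: less_induct)
  case less
  show ?case
  proof (cases "k = 0")
    case True
    then show ?thesis
      using less.prems init T_0 by simp
  next
    case False
    define l where "l = k - 1"
    have l: "k = l + 1" "0 \<le> l" "l < int n"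
      using False less.prems by (simp_all add: l_def)
    have j: "0 < j"
      using less.prems by simp
    note lessw = weight_less[OF j less.prems(4) l(2)]
    have here: "f (l, j) = T l j" "T l j \<noteq> 0"
      using less.hyps[of l j] lessw(3) l less.prems nz by simp_all
    let ?r = "right_level l j" and ?s = "left_level l j"
    have right: "(if Suc j = 2 * n then 1 else f (?r, Suc j)) = T ?r (Suc j)"
      using less.hyps[of ?r "Suc j"] lessw(1) l less.prems right_level_bounds[of l j] T_ends(2)[of ?r]
      by (cases "Suc j = 2 * n") auto
    have T: "T l j * T k j = 1 + T ?r (Suc j) * T ?s (j - 1)"
      using T_frieze[of j l] j l(1) by simp
    have "T l j * f (k, j) = T l j * T k j"
    proof (cases "j = Suc n")
      case True
      have "f (?r, Suc j) = T ?r (Suc j)"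
        using right True n3 by simp
      then have "T l j * f (k, j) = (1 + T ?r (Suc j))^2"
        using joint[of l] here(1) True l(1) by simp
      also have "\<dots> = 1 + T ?r (Suc j) * (T ?r (Suc j) + 2)"
        by (simp add: power2_eq_square algebra_simps)
      also have "T ?r (Suc j) + 2 = T ?s (j - 1)"
        using T_transvection[of l] l True L_center by (simp add: left_level_def)
      finally show ?thesis
        using T by simp
    next
      case False
      have "f (?s, j - 1) = T ?s (j - 1)"
        using less.hyps[of ?s "j - 1"] lessw(2) l less.prems left_level_bounds[of l j] False by simp
      then show ?thesis
        using frieze[of j l] here(1) right less.prems False l(1) T by simp
    qed
    then show ?thesis
      using here(2) by simp
  qed
qed

end



section \<open>The two quivers\<close>

definition arrow :: "('v, 'e) pre_digraph \<Rightarrow> 'v \<Rightarrow> 'v \<Rightarrow> bool" where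
  "arrow G i j \<longleftrightarrow> (\<exists>e\<in>arcs G. tail G e = i \<and> head G e = j)"

definition neighbours :: "('v, 'e) pre_digraph \<Rightarrow> 'v \<Rightarrow> 'v set" where
  "neighbours G i = {j. arrow G i j \<or> arrow G j i}"

text \<open>Injectivity on unordered pairs of ends excludes 2-cycles as well as multiple arrows, so
  an arrow at a vertex is known once the neighbour is.\<close>

definition simple_quiver :: "('v, 'e) pre_digraph \<Rightarrow> bool" where
  "simple_quiver G \<longleftrightarrow>
    inj_on (\<lambda>e. {tail G e, head G e}) (arcs G) \<and> (\<forall>e\<in>arcs G. tail G e \<noteq> head G e)"

lemma out_arcs_translation_quiver:
  "out_arcs (translation_quiver G) (k, i) =
    Level k ` {e \<in> arcs G. tail G e = i} \<union> Next k ` {e \<in> arcs G. head G e = i}"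
  by (auto simp: out_arcs_def translation_quiver_def)

lemma simple_quiver_eqI:
  assumes "simple_quiver G" "e \<in> arcs G" "e' \<in> arcs G" "{tail G e, head G e} = {tail G e', head G e'}"
  shows "e = e'"
  using assms unfolding simple_quiver_def inj_on_def by blast

lemma simple_quiver_not_arrow:
  assumes "simple_quiver G" "arrow G i j"
  shows "\<not> arrow G j i"
proof
  assume "arrow G j i"
  then obtain e e' where "e \<in> arcs G" "tail G e = i" "head G e = j"
    "e' \<in> arcs G" "tail G e' = j" "head G e' = i"
    using assms(2) by (auto simp: arrow_def)
  moreover from this have "e = e'"
    by (intro simple_quiver_eqI[OF assms(1)]) auto
  ultimately show False
    using assms(1) by (auto simp: simple_quiver_def)
qed

text \<open>In the translation quiver an arrow leaving (k, i) is recovered from the second component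
  of its head; its direction in \<open>G\<close> decides between the levels k and k + 1.\<close>

lemma frieze_of_simple_quiver:
  assumes G: "simple_quiver G" and a: "frieze_of G init a" and i: "i \<in> verts G"
  shows "a (k, i) * a (k + 1, i) =
    1 + (\<Prod>j\<in>neighbours G i. a (if arrow G i j then k else k + 1, j))"
proof -
  let ?T = "translation_quiver G" and ?O = "out_arcs (translation_quiver G) (k, i)"
  let ?h = "\<lambda>x. snd (head ?T x)"
  have heads: "head ?T (Level k e) = (k, head G e)" "head ?T (Next k e) = (k + 1, tail G e)" for e
    by (simp_all add: translation_quiver_def)
  have "inj_on ?h ?O"
  proof (rule inj_onI)
    fix x y assume xy: "x \<in> ?O" "y \<in> ?O" "?h x = ?h y"
    obtain e where e: "e \<in> arcs G" "x = Level k e \<and> tail G e = i \<or> x = Next k e \<and> head G e = i"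
      using xy(1) by (auto simp: out_arcs_translation_quiver)
    obtain e' where e': "e' \<in> arcs G" "y = Level k e' \<and> tail G e' = i \<or> y = Next k e' \<and> head G e' = i"
      using xy(2) by (auto simp: out_arcs_translation_quiver)
    have "e = e'"
      using e e' xy(3) by (intro simple_quiver_eqI[OF G]) (auto simp: heads)
    then show "x = y"
      using e e' xy(3) G by (auto simp: heads simple_quiver_def)
  qed
  moreover have "?h ` ?O = neighbours G i"
    by (auto simp: out_arcs_translation_quiver neighbours_def arrow_def image_Un image_image heads)
  ultimately have "bij_betw ?h ?O (neighbours G i)"
    by (simp add: bij_betw_def)
  then have "(\<Prod>x\<in>?O. a (if arrow G i (?h x) then k else k + 1, ?h x)) =
    (\<Prod>j\<in>neighbours G i. a (if arrow G i j then k else k + 1, j))"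
    by (rule prod.reindex_bij_betw)
  moreover have "a (head ?T x) = a (if arrow G i (?h x) then k else k + 1, ?h x)" if x: "x \<in> ?O" for x
  proof -
    consider e where "e \<in> arcs G" "x = Level k e" "tail G e = i"
      | e where "e \<in> arcs G" "x = Next k e" "head G e = i"
      using x by (auto simp: out_arcs_translation_quiver)
    then show ?thesis
    proof cases
      case 1
      then have "arrow G i (head G e)"
        by (auto simp: arrow_def)
      then show ?thesis
        by (simp add: 1 heads)
    next
      case 2
      then have "arrow G (tail G e) i"
        by (auto simp: arrow_def)
      then show ?thesis
        using simple_quiver_not_arrow[OF G] by (simp add: 2 heads)
    qed
  qed
  ultimately have "(\<Prod>x\<in>?O. a (head ?T x)) =
    (\<Prod>j\<in>neighbours G i. a (if arrow G i j then k else k + 1, j))"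
    by (metis (no_types, lifting) prod.cong)
  then show ?thesis
    using a i unfolding frieze_of_def by metis
qed

section \<open>Type D quivers and the doubled quiver of type A\<close>

locale D_quiver =
  fixes n :: nat and Q :: "(nat, 'e) pre_digraph"
  assumes n4: "4 \<le> n" and D: "type_D n Q"
begin

lemma arrow_edge: "arrow Q i j \<Longrightarrow> {i, j} \<in> D_edges n"
  using D by (force simp: arrow_def type_D_def bij_betw_def)

lemma edge_arrow: "{i, j} \<in> D_edges n \<Longrightarrow> arrow Q i j \<or> arrow Q j i"
proof -
  assume "{i, j} \<in> D_edges n"
  then have "{i, j} \<in> (\<lambda>e. {tail Q e, head Q e}) ` arcs Q"
    using D by (simp add: type_D_def bij_betw_def)
  then obtain e where "e \<in> arcs Q" "{tail Q e, head Q e} = {i, j}"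
    by force
  then show ?thesis
    by (auto simp: arrow_def doubleton_eq_iff)
qed

lemma simple_Q: "simple_quiver Q"
proof -
  have "tail Q e \<noteq> head Q e" if "e \<in> arcs Q" for e
  proof -
    have "{tail Q e, head Q e} \<in> D_edges n"
      using that arrow_edge[of "tail Q e" "head Q e"] by (auto simp: arrow_def)
    then show ?thesis
      by (auto simp: D_edges_def doubleton_eq_iff)
  qed
  then show ?thesis
    using D by (auto simp: simple_quiver_def type_D_def bij_betw_def)
qed

lemma arrow_reverse: "{i, j} \<in> D_edges n \<Longrightarrow> arrow Q j i \<longleftrightarrow> \<not> arrow Q i j"
  using edge_arrow simple_quiver_not_arrow[OF simple_Q] by blast

lemma neighbours_Q: "neighbours Q i = {j. {i, j} \<in> D_edges n}"
proof -
  have "arrow Q i j \<or> arrow Q j i \<longleftrightarrow> {i, j} \<in> D_edges n" for j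
    using arrow_edge[of i j] arrow_edge[of j i] edge_arrow[of i j] by (auto simp: insert_commute)
  then show ?thesis
    by (simp add: neighbours_def)
qed

lemma D_edge_iff:
  "{i, j} \<in> D_edges n \<longleftrightarrow> {i, j} = {1, 3} \<or> {i, j} = {2, 3} \<or>
    3 \<le> i \<and> i < n \<and> j = i + 1 \<or> 3 \<le> j \<and> j < n \<and> i = j + 1"
  by (auto simp: D_edges_def doubleton_eq_iff)

lemma neighbours_Q_simps:
  "neighbours Q 1 = {3}" "neighbours Q 2 = {3}" "neighbours Q 3 = {1, 2, 4}"
  "4 \<le> i \<Longrightarrow> i < n \<Longrightarrow> neighbours Q i = {i - 1, i + 1}"
  "neighbours Q n = {n - 1}"
  using n4 by (auto simp: neighbours_Q D_edge_iff doubleton_eq_iff)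

text \<open>The inverse of \<open>slot n\<close> on the right-hand copy.\<close>

definition vertex_at :: "nat \<Rightarrow> nat" where
  "vertex_at s = (if s = n + 1 then 1 else s + 1 - n)"

lemma slot_vertex_at: "n < s \<Longrightarrow> slot n (vertex_at s) = s"
  by (auto simp: slot_def vertex_at_def)

lemma vertex_at_slot: "i = 1 \<or> 3 \<le> i \<Longrightarrow> vertex_at (slot n i) = i"
  by (auto simp: slot_def vertex_at_def)

lemma vertex_at_edge:
  assumes "n < s" "s < 2 * n - 1"
  shows "{vertex_at s, vertex_at (Suc s)} \<in> D_edges n"
    and "vertex_at s \<noteq> 2" "vertex_at (Suc s) \<noteq> 2"
proof -
  have "{vertex_at s, vertex_at (Suc s)} \<in> D_edges n \<and> vertex_at s \<noteq> 2 \<and> vertex_at (Suc s) \<noteq> 2"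
  proof (cases "s = n + 1")
    case True
    then have "vertex_at s = 1" "vertex_at (Suc s) = 3"
      by (simp_all add: vertex_at_def)
    then show ?thesis
      by (simp add: D_edges_def)
  next
    case False
    define i where "i = s + 1 - n"
    have "vertex_at s = i" "vertex_at (Suc s) = i + 1" "3 \<le> i" "i < n"
      using assms False by (simp_all add: vertex_at_def i_def)
    then show ?thesis
      by (simp add: D_edge_iff)
  qed
  then show "{vertex_at s, vertex_at (Suc s)} \<in> D_edges n"
    "vertex_at s \<noteq> 2" "vertex_at (Suc s) \<noteq> 2"
    by simp_all
qed

text \<open>Direction of the arrow between the positions s and s + 1. In the left-hand copy this
  edge is the mirror image of the one between 2n - 1 - s and 2n - s; mirroring exchanges left and
  right, whence the negation.\<close>

definition rightward :: "nat \<Rightarrow> bool" where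
  "rightward s \<longleftrightarrow> (if s = n - 1 \<or> s = n then True
    else if n < s then arrow Q (vertex_at s) (vertex_at (Suc s))
    else \<not> arrow Q (vertex_at (2 * n - 1 - s)) (vertex_at (2 * n - s)))"

definition orient :: "nat \<Rightarrow> nat \<times> nat" where
  "orient s = (if rightward s then (s, Suc s) else (Suc s, s))"

lemma rightward_right: "n < s \<Longrightarrow> rightward s \<longleftrightarrow> arrow Q (vertex_at s) (vertex_at (Suc s))"
  by (auto simp: rightward_def)

lemma right_copy:
  "(\<lambda>e. (slot n (tail Q e), slot n (head Q e))) ` arcs (omega_bar Q) = orient ` {n<..<2 * n - 1}"
proof -
  have arcs: "arcs (omega_bar Q) = {e \<in> arcs Q. tail Q e \<noteq> 2 \<and> head Q e \<noteq> 2}"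
  proof -
    have "tail Q e \<in> verts Q \<and> head Q e \<in> verts Q" if "e \<in> arcs Q" for e
    proof -
      have "{tail Q e, head Q e} \<in> D_edges n"
        using that arrow_edge[of "tail Q e" "head Q e"] by (auto simp: arrow_def)
      then show ?thesis
        using D n4 by (auto simp: D_edge_iff doubleton_eq_iff type_D_def)
    qed
    then show ?thesis
      by (auto simp: omega_bar_def induce_subgraph_def)
  qed
  have "(slot n i, slot n j) \<in> orient ` {n<..<2 * n - 1}" if "arrow Q i j" "i \<noteq> 2" "j \<noteq> 2" for i j
  proof -
    have e: "{i, j} \<in> D_edges n"
      using that(1) by (rule arrow_edge)
    then have ij: "i = 1 \<or> 3 \<le> i" "j = 1 \<or> 3 \<le> j"
      using that by (auto simp: D_edge_iff doubleton_eq_iff)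
    from e that consider "slot n j = Suc (slot n i)" "n < slot n i" "slot n i < 2 * n - 1"
      | "slot n i = Suc (slot n j)" "n < slot n j" "slot n j < 2 * n - 1"
      using n4 by (auto simp: D_edge_iff doubleton_eq_iff slot_def)
    then show ?thesis
    proof cases
      case 1
      then have "rightward (slot n i)"
        using that ij vertex_at_slot[of i] vertex_at_slot[of j] by (simp add: rightward_right)
      then show ?thesis
        using 1 by (auto simp: orient_def intro!: image_eqI[of _ _ "slot n i"])
    next
      case 2
      then have "\<not> rightward (slot n j)"
        using that ij vertex_at_slot[of i] vertex_at_slot[of j] simple_quiver_not_arrow[OF simple_Q]
        by (auto simp: rightward_right)
      then show ?thesis
        using 2 by (auto simp: orient_def intro!: image_eqI[of _ _ "slot n j"])
    qed
  qed
  moreover have "\<exists>i j. arrow Q i j \<and> i \<noteq> 2 \<and> j \<noteq> 2 \<and> orient s = (slot n i, slot n j)"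
    if "n < s" "s < 2 * n - 1" for s
  proof (cases "rightward s")
    case True
    then show ?thesis
      using that vertex_at_edge[OF that] slot_vertex_at[of s] slot_vertex_at[of "Suc s"]
      by (intro exI[of _ "vertex_at s"] exI[of _ "vertex_at (Suc s)"])
        (auto simp: orient_def rightward_right)
  next
    case False
    then show ?thesis
      using that vertex_at_edge[OF that] slot_vertex_at[of s] slot_vertex_at[of "Suc s"]
        arrow_reverse[OF vertex_at_edge(1)[OF that]]
      by (intro exI[of _ "vertex_at (Suc s)"] exI[of _ "vertex_at s"])
        (auto simp: orient_def rightward_right)
  qed
  ultimately show ?thesis
    unfolding arcs by (fastforce simp: arrow_def)
qed

lemma rightward_mirror:
  assumes "n < s" "s < 2 * n - 1"
  shows "rightward (2 * n - 1 - s) \<longleftrightarrow> \<not> rightward s"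
proof -
  have "2 * n - 1 - (2 * n - 1 - s) = s" "2 * n - (2 * n - 1 - s) = Suc s"
    "2 * n - 1 - s < n - 1"
    using assms by simp_all
  then show ?thesis
    using assms by (auto simp: rightward_def)
qed

text \<open>The map taking p to 2n - p carries the right-hand copy to the left-hand one, so
  \<open>right_copy\<close> settles both.\<close>

lemma arcs_doubled_quiver: "arcs (doubled_quiver n Q) = orient ` {0<..<2 * n - 1}"
proof -
  let ?m = "\<lambda>(p, q). (2 * n - p, 2 * n - q)"
  have "(\<lambda>e. (2 * n - slot n (tail Q e), 2 * n - slot n (head Q e))) ` arcs (omega_bar Q) =
    ?m ` (\<lambda>e. (slot n (tail Q e), slot n (head Q e))) ` arcs (omega_bar Q)"
    by (simp add: image_image)
  also have "\<dots> = (\<lambda>s. ?m (orient s)) ` {n<..<2 * n - 1}"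
    unfolding right_copy by (simp add: image_image)
  also have "\<dots> = (\<lambda>s. orient (2 * n - 1 - s)) ` {n<..<2 * n - 1}"
  proof (rule image_cong)
    fix s assume "s \<in> {n<..<2 * n - 1}"
    then show "?m (orient s) = orient (2 * n - 1 - s)"
      using rightward_mirror[of s] by (auto simp: orient_def)
  qed simp
  also have "\<dots> = orient ` {0<..<n - 1}"
  proof -
    have "(\<lambda>s. 2 * n - 1 - s) ` {n<..<2 * n - 1} = {0<..<n - 1}"
    proof
      show "{0<..<n - 1} \<subseteq> (\<lambda>s. 2 * n - 1 - s) ` {n<..<2 * n - 1}"
      proof
        fix t assume "t \<in> {0<..<n - 1}"
        then show "t \<in> (\<lambda>s. 2 * n - 1 - s) ` {n<..<2 * n - 1}"
          by (intro image_eqI[of _ _ "2 * n - 1 - t"]) auto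
      qed
    qed auto
    then show ?thesis
      by (metis image_image)
  qed
  finally have left: "(\<lambda>e. (2 * n - slot n (tail Q e), 2 * n - slot n (head Q e))) ` arcs (omega_bar Q) =
    orient ` {0<..<n - 1}" .
  have "{0<..<2 * n - 1} = {0<..<n - 1} \<union> {n - 1, n} \<union> {n<..<2 * n - 1}"
    using n4 by auto
  moreover have "orient ` {n - 1, n} = {(n - 1, n), (n, n + 1)}"
    using n4 by (auto simp: orient_def rightward_def)
  moreover have "arcs (doubled_quiver n Q) =
    orient ` {0<..<n - 1} \<union> {(n - 1, n), (n, n + 1)} \<union> orient ` {n<..<2 * n - 1}"
    unfolding doubled_quiver_def by (simp only: pre_digraph.select_convs left right_copy)
  ultimately show ?thesis
    by (simp only: image_Un)
qed

lemma ends_doubled_quiver: "tail (doubled_quiver n Q) = fst" "head (doubled_quiver n Q) = snd"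
  by (simp_all add: doubled_quiver_def)

lemma arrow_doubled_quiver:
  "arrow (doubled_quiver n Q) p q \<longleftrightarrow>
    0 < p \<and> q = Suc p \<and> q < 2 * n \<and> rightward p \<or> 0 < q \<and> p = Suc q \<and> p < 2 * n \<and> \<not> rightward q"
proof -
  have "arrow (doubled_quiver n Q) p q \<longleftrightarrow> (p, q) \<in> arcs (doubled_quiver n Q)"
    by (force simp: arrow_def ends_doubled_quiver)
  then show ?thesis
    by (auto simp: arcs_doubled_quiver orient_def image_iff split: if_splits)
qed

lemma simple_doubled_quiver: "simple_quiver (doubled_quiver n Q)"
proof -
  show ?thesis
    unfolding simple_quiver_def arcs_doubled_quiver ends_doubled_quiver
    by (auto simp: inj_on_def orient_def doubleton_eq_iff)
qed

lemma neighbours_doubled_quiver: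
  "0 < j \<Longrightarrow> j < 2 * n \<Longrightarrow> neighbours (doubled_quiver n Q) j =
    (if j = 1 then {} else {j - 1}) \<union> (if Suc j = 2 * n then {} else {Suc j})"
  by (auto simp: neighbours_def arrow_doubled_quiver)

lemma frieze_doubled_quiver:
  assumes "frieze_of (doubled_quiver n Q) init f" "0 < j" "j < 2 * n"
  shows "f (k, j) * f (k + 1, j) =
    1 + (if Suc j = 2 * n then 1 else f (if rightward j then k else k + 1, Suc j)) *
      (if j = 1 then 1 else f (if rightward (j - 1) then k + 1 else k, j - 1))"
proof -
  have "j \<in> verts (doubled_quiver n Q)"
    using assms by (auto simp: doubled_quiver_def)
  then have *: "f (k, j) * f (k + 1, j) = 1 + (\<Prod>i\<in>neighbours (doubled_quiver n Q) j.
      f (if arrow (doubled_quiver n Q) j i then k else k + 1, i))"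
    by (rule frieze_of_simple_quiver[OF simple_doubled_quiver assms(1)])
  have "Suc j < 2 * n \<Longrightarrow> arrow (doubled_quiver n Q) j (Suc j) = rightward j"
    "1 < j \<Longrightarrow> arrow (doubled_quiver n Q) j (j - 1) = (\<not> rightward (j - 1))"
    using assms by (auto simp: arrow_doubled_quiver)
  then show ?thesis
    unfolding * neighbours_doubled_quiver[OF assms(2,3)] using assms n4
    by (cases "j = 1"; cases "Suc j = 2 * n") auto
qed

end



section \<open>The relations of the modelled quiver and the symmetry of its boundary word\<close>

context D_quiver
begin

lemma vertex_at_simps: "vertex_at (Suc n) = 1" "n + 1 < j \<Longrightarrow> vertex_at j = j + 1 - n"
  by (simp_all add: vertex_at_def)

text \<open>The form in which the hypothesis on the fork is used: in the relation at the joint, the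
  vertices 1 and 2 occur at the same level, so their product is a value at the glued vertex.\<close>

lemma fork_arrows_agree:
  assumes "(\<forall>e \<in> fork_arrows Q. head Q e = 3) \<or> (\<forall>e \<in> fork_arrows Q. tail Q e = 3)"
  shows "arrow Q 1 3 \<longleftrightarrow> arrow Q 2 3"
proof -
  have heads: "arrow Q i 3" if "\<forall>e \<in> fork_arrows Q. head Q e = 3" "i \<in> {1, 2}" for i
  proof -
    have "{i, 3} \<in> D_edges n"
      using that(2) by (auto simp: D_edges_def)
    moreover have "\<not> arrow Q 3 i"
      using that by (force simp: arrow_def fork_arrows_def insert_commute)
    ultimately show ?thesis
      using edge_arrow by blast
  qed
  have tails: "\<not> arrow Q i 3" if "\<forall>e \<in> fork_arrows Q. tail Q e = 3" "i \<in> {1, 2}" for i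
    using that by (force simp: arrow_def fork_arrows_def)
  show ?thesis
    using assms heads[of 1] heads[of 2] tails[of 1] tails[of 2] by blast
qed

text \<open>The relations at 1 and 2 have the same right side, so their product is a square. At the
  joint the factors of 1 and 2 merge into the glued value, and further along the branch the relation
  is that of type D unchanged.\<close>

lemma frieze_modelled:
  assumes a: "frieze_of Q init a"
    and fork: "(\<forall>e \<in> fork_arrows Q. head Q e = 3) \<or> (\<forall>e \<in> fork_arrows Q. tail Q e = 3)"
  defines "f \<equiv> \<lambda>(k, j). modelled_value a (k, vertex_at j)"
  shows "f (k, Suc n) * f (k + 1, Suc n) =
      (1 + f (if rightward (Suc n) then k else k + 1, Suc (Suc n)))^2"
    and "Suc n < j \<Longrightarrow> j < 2 * n \<Longrightarrow> f (k, j) * f (k + 1, j) =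
      1 + (if Suc j = 2 * n then 1 else f (if rightward j then k else k + 1, Suc j)) *
        f (if rightward (j - 1) then k + 1 else k, j - 1)"
proof -
  have verts: "verts Q = {1..n}"
    using D by (simp add: type_D_def)
  note Q = frieze_of_simple_quiver[OF simple_Q a]
  have f1: "f (l, Suc n) = a (l, 1) * a (l, 2)" for l
    by (simp add: f_def modelled_value_def vertex_at_simps)
  have f2: "f (l, j) = a (l, j + 1 - n)" if "n + 1 < j" for l j
  proof -
    have "j + 1 - n \<noteq> 1"
      using that by simp
    then show ?thesis
      using that by (simp add: f_def modelled_value_def vertex_at_simps)
  qed
  have right: "rightward j = arrow Q (vertex_at j) (vertex_at (Suc j))" if "n < j" for j
    using that by (rule rightward_right)
  have fork': "rightward (Suc n) = arrow Q 1 3" "arrow Q 2 3 = arrow Q 1 3"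
    using fork_arrows_agree[OF fork] right[of "Suc n"] by (simp_all add: vertex_at_simps)
  have three: "f (l, Suc (Suc n)) = a (l, 3)" for l
    by (simp add: f2)
  have "a (k, 1) * a (k + 1, 1) = 1 + a (if arrow Q 1 3 then k else k + 1, 3)"
    "a (k, 2) * a (k + 1, 2) = 1 + a (if arrow Q 1 3 then k else k + 1, 3)"
    using Q[of 1 k] Q[of 2 k] n4
    by (simp_all add: verts neighbours_Q_simps neighbours_Q_simps(1)[unfolded One_nat_def] fork'(2))
  then have "(a (k, 1) * a (k + 1, 1)) * (a (k, 2) * a (k + 1, 2)) =
      (1 + a (if arrow Q 1 3 then k else k + 1, 3))^2"
    by (simp add: power2_eq_square)
  then show "f (k, Suc n) * f (k + 1, Suc n) =
      (1 + f (if rightward (Suc n) then k else k + 1, Suc (Suc n)))^2"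
    unfolding f1 three fork' by (simp only: ac_simps)
  show "f (k, j) * f (k + 1, j) =
      1 + (if Suc j = 2 * n then 1 else f (if rightward j then k else k + 1, Suc j)) *
        f (if rightward (j - 1) then k + 1 else k, j - 1)" if j: "Suc n < j" "j < 2 * n"
  proof -
    define i where "i = j + 1 - n"
    have i: "3 \<le> i" "i \<le> n" "Suc j = 2 * n \<longleftrightarrow> i = n" "Suc j + 1 - n = i + 1" "Suc j - n = i"
      using j by (auto simp: i_def)
    have lhs: "f (k, j) * f (k + 1, j) = 1 + (\<Prod>l\<in>neighbours Q i. a (if arrow Q i l then k else k + 1, l))"
      using Q[of i k] i j by (simp add: f2 verts)
    have up: "rightward j = arrow Q i (i + 1)"
      using right[of j] j i(4,5) by (simp add: vertex_at_simps)
    have fup: "f (l, Suc j) = a (l, i + 1)" for l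
      using j i(4) by (simp add: f2)
    show ?thesis
    proof (cases "i = 3")
      case True
      then have "j = Suc (Suc n)"
        using j by (simp add: i_def)
      then have down: "rightward (j - 1) = arrow Q 1 3"
        and fdown: "f (l, j - 1) = a (l, 1) * a (l, 2)" for l
        using fork' f1 by simp_all
      have "{1, 3} \<in> D_edges n" "{2, 3} \<in> D_edges n"
        by (simp_all add: D_edges_def)
      then have "arrow Q 3 1 \<longleftrightarrow> \<not> arrow Q 1 3" "arrow Q 3 2 \<longleftrightarrow> \<not> arrow Q 1 3"
        using arrow_reverse[of 1 3] arrow_reverse[of 2 3] fork'(2) by simp_all
      moreover have "i \<noteq> n"
        using True n4 by simp
      ultimately show ?thesis
        unfolding lhs down fdown up fup i(3) using True
        by (simp add: neighbours_Q_simps mult.assoc mult.left_commute mult.commute)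
    next
      case False
      then have i4: "4 \<le> i"
        using i by simp
      then have "n + 1 < j - 1" "j - 1 + 1 - n = i - 1" "Suc (j - 1) = j" "n < j - 1"
        using j by (auto simp: i_def)
      then have down: "rightward (j - 1) = arrow Q (i - 1) i"
        and fdown: "f (l, j - 1) = a (l, i - 1)" for l
        using right[of "j - 1"] j i(5) by (simp_all add: vertex_at_simps f2)
      have "{i - 1, i} \<in> D_edges n"
        using i4 i(2) by (auto simp: D_edge_iff)
      then have "arrow Q i (i - 1) \<longleftrightarrow> \<not> arrow Q (i - 1) i"
        by (rule arrow_reverse)
      then show ?thesis
        unfolding lhs down fdown up fup i(3) using i4 i(2) neighbours_Q_simps(4)[of i]
        by (cases "i = n") (simp_all add: neighbours_Q_simps(5) mult.commute)
    qed
  qed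
qed

lemma length_boundary_labels: "length (boundary_labels n u) = 2 * n - 1"
  using n4 by (simp add: boundary_labels_def)

lemma boundary_labels_right:
  assumes "n < j" "j < 2 * n"
  shows "boundary_labels n u ! (j - 1) = (if j = Suc n then u 1 * u 2 else u (j + 1 - n))"
proof (cases "j = Suc n")
  case True
  moreover obtain m where "n = 4 + m"
    using n4 le_Suc_ex by blast
  ultimately show ?thesis
    by (simp add: boundary_labels_def nth_append)
next
  case False
  let ?xs = "map u (rev [3..<n + 1]) @ [u 1 * u 2, 1, u 1 * u 2]"
  have "boundary_labels n u = ?xs @ map u [3..<n + 1]" "length ?xs = n + 1"
    using n4 by (simp_all add: boundary_labels_def)
  then have "boundary_labels n u ! (j - 1) = map u [3..<n + 1] ! (j - 1 - (n + 1))"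
    using assms False by (simp only: nth_append) simp
  also have "\<dots> = u (3 + (j - 1 - (n + 1)))"
    using assms False by (simp del: upt_Suc)
  also have "3 + (j - 1 - (n + 1)) = j + 1 - n"
    using assms False by simp
  finally show ?thesis
    using False by simp
qed

lemma boundary_labels_center: "boundary_labels n u ! (n - 1) = 1"
proof -
  obtain m where "n = 4 + m"
    using n4 le_Suc_ex by blast
  then show ?thesis
    by (simp add: boundary_labels_def nth_append)
qed

lemma rev_boundary_labels: "rev (boundary_labels n u) = boundary_labels n u"
  by (simp add: boundary_labels_def rev_map)

definition inner_letters :: "letter list" where
  "inner_letters = map (\<lambda>j. if rightward j then Lx else Ly) [1..<2 * n - 1]"

lemma Lambda'_eq: "Lambda' n Q u = (boundary_labels n u, inner_letters)"
proof -
  have "(j, j + 1) \<in> arcs (doubled_quiver n Q) \<longleftrightarrow> rightward j" if "j \<in> set [1..<2 * n - 1]" for j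
    using that by (auto simp: arcs_doubled_quiver orient_def image_iff split: if_splits)
  then show ?thesis
    by (simp add: Lambda'_def inner_letters_def)
qed

lemma bdry_F_simps:
  "fst (bdry_F n Q u) = 1 # boundary_labels n u @ [1]"
  "snd (bdry_F n Q u) = Ly # inner_letters @ [Lx]"
  by (simp_all add: bdry_F_def enclose_def Lambda'_eq)

lemma bdry_tF_simps:
  "fst (bdry_tF n Q u) = 1 # boundary_labels n u @ [1]"
  "snd (bdry_tF n Q u) = Lx # map swap_letter (rev inner_letters) @ [Ly]"
  by (simp_all add: bdry_tF_def enclose_def transpose_word_def Lambda'_eq rev_boundary_labels rev_map)

lemma length_inner_letters: "length inner_letters = 2 * n - 2"
  by (simp add: inner_letters_def)

lemma inner_letters_nth:
  "m < 2 * n - 2 \<Longrightarrow> inner_letters ! m = (if rightward (Suc m) then Lx else Ly)"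
  by (simp add: inner_letters_def)

lemma bdry_F_nth:
  assumes "0 < j"
  shows "j < 2 * n - 1 \<Longrightarrow> snd (bdry_F n Q u) ! j = (if rightward j then Lx else Ly)"
    and "j < 2 * n \<Longrightarrow> fst (bdry_F n Q u) ! j = boundary_labels n u ! (j - 1)"
proof -
  obtain m where m: "j = Suc m"
    using assms by (cases j) auto
  show "snd (bdry_F n Q u) ! j = (if rightward j then Lx else Ly)" if "j < 2 * n - 1"
  proof -
    have "m < 2 * n - 2"
      using that m by simp
    then show ?thesis
      by (simp add: m bdry_F_simps nth_append length_inner_letters inner_letters_nth)
  qed
  show "fst (bdry_F n Q u) ! j = boundary_labels n u ! (j - 1)" if "j < 2 * n"
  proof -
    have "m < 2 * n - 1"
      using that m by simp
    then show ?thesis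
      by (simp add: m bdry_F_simps nth_append length_boundary_labels)
  qed
qed

lemma symmetric_boundary_F:
  fixes u :: "nat \<Rightarrow> 'a::field"
  assumes "\<And>i. u i \<noteq> 0"
  shows "symmetric_boundary n (snd (bdry_F n Q u)) (snd (bdry_tF n Q u))
    (fst (bdry_F n Q u)) (fst (bdry_tF n Q u))"
    (is "symmetric_boundary n ?L ?tL ?b ?tb")
proof
  show "2 \<le> n" "length ?L = 2 * n" "length ?b = 2 * n + 1" "length ?tL = 2 * n" "length ?tb = 2 * n + 1"
    using n4
    by (simp_all add: bdry_F_simps bdry_tF_simps length_boundary_labels length_inner_letters)
  show L0: "?L ! 0 = Ly" and "?tL ! 0 = Lx" and "?b ! 0 = 1"
    by (simp_all add: bdry_F_simps bdry_tF_simps)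
  show "?L ! (n - 1) = Lx" "?L ! n = Lx"
    using n4 bdry_F_nth(1)[of "n - 1" u] bdry_F_nth(1)[of n u] by (simp_all add: rightward_def)
  have Llast: "?L ! (2 * n - 1) = Lx"
    using n4 nth_append_length[of "Ly # inner_letters" Lx "[]"]
    by (simp add: bdry_F_simps length_inner_letters Suc_diff_Suc numeral_2_eq_2)
  show "?tL ! (2 * n - 1) = Ly"
    using n4 nth_append_length[of "Lx # map swap_letter (rev inner_letters)" Ly "[]"]
    by (simp add: bdry_tF_simps length_inner_letters Suc_diff_Suc numeral_2_eq_2)
  show "?L ! (2 * n - 1 - j) = swap_letter (?L ! j)" if "j < n - 1" for j
  proof (cases "j = 0")
    case True
    then show ?thesis
      using L0 Llast by simp
  next
    case False
    then show ?thesis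
      using that rightward_mirror[of "2 * n - 1 - j"] bdry_F_nth(1)[of j u] bdry_F_nth(1)[of "2 * n - 1 - j" u]
      by auto
  qed
  show "?tL ! j = swap_letter (?L ! (2 * n - 1 - j))" if "1 \<le> j" "j \<le> 2 * n - 2" for j
  proof -
    obtain m where m: "j = Suc m" "m < 2 * n - 2"
      using \<open>1 \<le> j\<close> \<open>j \<le> 2 * n - 2\<close> by (cases j) auto
    then have "2 * n - 1 - j = Suc (2 * n - 2 - j)" "2 * n - 2 - j < 2 * n - 2"
      by simp_all
    then have "?L ! (2 * n - 1 - j) = inner_letters ! (2 * n - 2 - j)"
      by (simp add: bdry_F_simps nth_append length_inner_letters)
    moreover have "?tL ! j = swap_letter (inner_letters ! (2 * n - 2 - j))"
      using m by (simp add: bdry_tF_simps nth_append length_inner_letters rev_nth)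
    ultimately show ?thesis
      by simp
  qed
  show "?b ! n = 1"
    using n4 bdry_F_nth(2)[of n u] boundary_labels_center[of u] by simp
  have "rev ?b = ?b"
    by (simp add: bdry_F_simps rev_boundary_labels)
  then show "?b ! (2 * n - j) = ?b ! j" if "j \<le> 2 * n" for j
    using that rev_nth[of j ?b] n4 by (simp add: bdry_F_simps length_boundary_labels)
  show "?tb ! j = ?b ! j" for j
    by (simp add: bdry_F_simps bdry_tF_simps)
  have "0 \<notin> set ?b"
    using assms by (auto simp: bdry_F_simps boundary_labels_def)
  then show "?b ! j \<noteq> 0" if "j \<le> 2 * n" for j
    using that n4 nth_mem[of j ?b] by (auto simp: bdry_F_simps length_boundary_labels)
qed

end



section \<open>Comparison of both friezes with the matrix formulas\<close>

theorem theorem3p6: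
  fixes n :: nat
    and Q :: "(nat, 'e) pre_digraph"
    and a ups :: "int \<times> nat \<Rightarrow> ratfun"
  assumes "n \<ge> 4"
    and "type_D n Q"
    and "(\<forall>e \<in> fork_arrows Q. head Q e = 3) \<or> (\<forall>e \<in> fork_arrows Q. tail Q e = 3)"
    and "frieze_of Q indet a"
    and "frieze_of (doubled_quiver n Q) (Upsilon_init n indet) ups"
    and "p \<in> modelled_verts n"
  shows "(\<forall>w. same_word n Q indet (modelled_point n Q indet p) w \<or>
              mixed_word n Q indet (modelled_point n Q indet p) w
            \<longrightarrow> word_m w \<ge> 1)
       \<and> (\<forall>z. T_value n Q indet ups (modelled_point n Q indet p) z
            \<longleftrightarrow> z = modelled_value a p)"
proof -
  interpret D_quiver n Q
    using assms(1,2) by unfold_locales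
  define L tL where "L = snd (bdry_F n Q (indet :: nat \<Rightarrow> ratfun))"
    and "tL = snd (bdry_tF n Q (indet :: nat \<Rightarrow> ratfun))"
  define b tb where "b = fst (bdry_F n Q (indet :: nat \<Rightarrow> ratfun))"
    and "tb = fst (bdry_tF n Q (indet :: nat \<Rightarrow> ratfun))"
  have indet_nonzero: "indet i \<noteq> 0" for i
    using positive_cone_indet[of i] positive_cone_nonzero by metis
  interpret symmetric_boundary n L tL b tb
    unfolding L_def tL_def b_def tb_def by (rule symmetric_boundary_F) (rule indet_nonzero)
  obtain v :: "int \<Rightarrow> ratfun \<times> ratfun" where "\<And>i. cross (v i) (v (i + 1)) = 1"
    "\<And>i. v (i + (2 * int n + 2)) = - v i"
    "\<And>j. j \<le> 2 * n \<Longrightarrow> cross (v (- Y j - 1)) (v (X j)) = b ! j"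
    using ex_strip_vectors by metis
  then interpret strip n L tL b tb v
    by unfold_locales
  have L_nth: "L ! j = Lx \<longleftrightarrow> rightward j" if "0 < j" "j < 2 * n - 1" for j
    using bdry_F_nth(1)[OF that, where u = "indet :: nat \<Rightarrow> ratfun"] by (simp add: L_def)
  have b_nth: "b ! j = boundary_labels n indet ! (j - 1)" if "0 < j" "j < 2 * n" for j
    using bdry_F_nth(2)[OF that] by (simp add: b_def)
  have "set b \<subseteq> positive_cone"
    by (auto simp: b_def bdry_F_simps boundary_labels_def
        intro!: positive_cone_one positive_cone_indet positive_cone_mult)
  then have b_cone: "b ! j \<in> positive_cone" if "j \<le> 2 * n" for j
    using that length_b nth_mem[of j b] by auto

  \<comment> \<open>Besides the values on the boundary, this provides the nonvanishing of
    \<open>T\<close> that the comparison with the modelled quiver requires.\<close>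
  have ups_T: "ups (k, j) = T k j \<and> T k j \<in> positive_cone" if "0 \<le> k" "0 < j" "j < 2 * n" for k j
  proof (rule frieze_eq_T[OF positive_cone_nonzero positive_cone_one positive_cone_add
        positive_cone_mult positive_cone_divide b_cone _ _ that])
    show "ups (0, j) = b ! j" if "0 < j" "j < 2 * n" for j
      using assms(5) that b_nth[OF that]
      by (simp add: frieze_of_def doubled_quiver_def Upsilon_init_def)
    show "ups (k, j) * ups (k + 1, j) =
      1 + (if Suc j = 2 * n then 1 else ups (right_level k j, Suc j)) *
        (if j = 1 then 1 else ups (left_level k j, j - 1))" if "0 < j" "j < 2 * n" for k j
    proof -
      have "Suc j \<noteq> 2 * n \<Longrightarrow> right_level k j = (if rightward j then k else k + 1)"
        "j \<noteq> 1 \<Longrightarrow> left_level k j = (if rightward (j - 1) then k + 1 else k)"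
        using L_nth[of j] L_nth[of "j - 1"] that by (simp_all add: right_level_def left_level_def)
      then show ?thesis
        using frieze_doubled_quiver[OF assms(5) that, of k] by (simp split del: if_split cong: if_cong)
    qed
  qed
  then have T_nonzero: "T k j \<noteq> 0" if "0 \<le> k" "0 < j" "j < 2 * n" for k j
    using that positive_cone_nonzero by metis

  define f where "f = (\<lambda>(k, j). modelled_value a (k, vertex_at j))"
  have f_T: "f (k, j) = T k j" if "0 \<le> k" "k \<le> int n" "n < j" "j < 2 * n" for k j
  proof (rule modelled_eq_T[OF _ T_nonzero _ _ _ that])
    show "3 \<le> n"
      using assms(1) by simp
    show "f (0, j) = b ! j" if "n < j" "j < 2 * n" for j
    proof -
      have "a (0, i) = indet i" if "1 \<le> i" "i \<le> n" for i
        using assms(2,4) that by (simp add: frieze_of_def type_D_def)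
      then show ?thesis
        using that b_nth[of j] boundary_labels_right[OF that, of "indet :: nat \<Rightarrow> ratfun"] assms(1)
        by (auto simp: f_def modelled_value_def vertex_at_def)
    qed
    show "f (k, Suc n) * f (k + 1, Suc n) = (1 + f (right_level k (Suc n), Suc (Suc n)))^2" for k
      using frieze_modelled(1)[OF assms(4,3), of k] L_nth[of "Suc n"] assms(1)
      by (simp add: f_def right_level_def)
    show "f (k, j) * f (k + 1, j) =
      1 + (if Suc j = 2 * n then 1 else f (right_level k j, Suc j)) * f (left_level k j, j - 1)"
      if "Suc n < j" "j < 2 * n" for k j
    proof -
      have "Suc j \<noteq> 2 * n \<Longrightarrow> L ! j = Lx \<longleftrightarrow> rightward j" "L ! (j - 1) = Lx \<longleftrightarrow> rightward (j - 1)"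
        using L_nth[of j] L_nth[of "j - 1"] that by simp_all
      then show ?thesis
        using frieze_modelled(2)[OF assms(4,3) that, of k, folded f_def]
        by (simp add: right_level_def left_level_def)
    qed
  qed

  obtain k i where p: "p = (k, i)" "0 \<le> k" "k \<le> int n" "i = 1 \<or> 3 \<le> i \<and> i \<le> n"
    using assms(6) by (auto simp: modelled_verts_def)
  define s where "s = slot n i"
  have s: "n < s" "s < 2 * n" "vertex_at s = i"
    using p(4) assms(1) by (auto simp: s_def slot_def vertex_at_def)
  define x y where "x = X s + k" and "y = Y s - k"
  have xy: "val x y = T k s" "x + y = int s"
    using coordinate_sum(1)[of s] by (simp_all add: x_def y_def T_def)
  have modelled_T: "modelled_value a p = T k s"
    using f_T[of k s] p s by (simp add: f_def)
  have path: "path_F n Q (indet :: nat \<Rightarrow> ratfun) j = (X j, Y j)"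
    "path_tF n Q (indet :: nat \<Rightarrow> ratfun) j = (TX j, TY j)" for j
    by (simp_all add: path_F_def path_tF_def X_def Y_def TX_def TY_def flip: L_def tL_def)
  have point: "modelled_point n Q (indet :: nat \<Rightarrow> ratfun) p = (x, y)"
    by (simp add: p(1) modelled_point_def Upsilon_point_def path x_def y_def flip: s_def)
  have boundary: "on_boundary n Q (indet :: nat \<Rightarrow> ratfun) (x', y') \<longleftrightarrow> \<not> off_boundary x' y'" for x' y'
    by (auto simp: on_boundary_def off_boundary_def path image_iff)
  have proj: "hproj_F n Q (indet :: nat \<Rightarrow> ratfun) (x', y') = hF x' y'"
    "vproj_F n Q (indet :: nat \<Rightarrow> ratfun) (x', y') = vF x' y'"
    "hproj_tF n Q (indet :: nat \<Rightarrow> ratfun) (x', y') = hT x' y'"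
    "vproj_tF n Q (indet :: nat \<Rightarrow> ratfun) (x', y') = vT x' y'" for x' y'
    by (simp_all add: hproj_F_def vproj_F_def hproj_tF_def vproj_tF_def hF_def vF_def hT_def vT_def path)
  have bdry: "bdry_F n Q (indet :: nat \<Rightarrow> ratfun) = (b, L)" "bdry_tF n Q (indet :: nat \<Rightarrow> ratfun) = (tb, tL)"
    by (simp_all add: b_def L_def tb_def tL_def)
  \<comment> \<open>The slices 0 and n lie on F and on its transpose respectively.\<close>
  have inner: "k \<noteq> 0 \<and> k \<noteq> int n" if "off_boundary x y"
    using that on_boundary_ends[OF s(1,2), of k] by (auto simp: x_def y_def)

  have same_value: "1 \<le> word_m w \<and> word_formula w (vector [1, fst w ! (word_m w + 1)]) = modelled_value a p"
    if "same_word n Q indet (x, y) w" for w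
    using that
  proof cases
    case (on_F i j)
    then show ?thesis
      using same_word_on_F[of x y i j] by (simp add: boundary proj bdry modelled_T xy)
  next
    case (on_tF i j)
    then show ?thesis
      using same_word_on_tF[of x y i j] by (simp add: boundary proj bdry modelled_T xy)
  qed
  have mixed_value: "1 \<le> word_m w \<and> word_formula w (vector [fst w ! (word_m w + 1), 1]) = modelled_value a p"
    if "mixed_word n Q indet (x, y) w" for w
    using that
  proof cases
    case (1 i j)
    then have off: "off_boundary x y"
      by (simp add: boundary)
    \<comment> \<open>The last step of F is the added letter x, so every earlier vertex is at least
      one unit to the left of n + 1. This gives the bound on \<open>x\<close> for mixed
      words.\<close>
    have "X s \<le> int n"
    proof -
      have "X s \<le> X (2 * n - 1)"
        using s(2) by (intro mono) simp
      also have "X (2 * n - 1) = int n"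
        using steps(1)[of "2 * n - 1"] L_last finish(1) assms(1) by simp
      finally show ?thesis .
    qed
    then have "x \<le> 2 * int n - 1" "x + y \<le> 2 * int n - 1"
      using inner[OF off] p(3) s(2) xy(2) by (simp_all add: x_def)
    then show ?thesis
      using 1 mixed_word_value[OF off, of i j] by (simp add: proj bdry modelled_T xy)
  qed

  \<comment> \<open>Some clause applies at every point, because the required projections exist; that
    no clause gives another value is shown afterwards by evaluating each of them.\<close>
  have "T_value n Q indet ups (x, y) (modelled_value a p)"
  proof (cases "off_boundary x y")
    case False
    have "T_value n Q indet ups (x, y) (ups (k, s))"
      by (rule T_value.boundary)
        (use False s in \<open>auto simp: boundary Upsilon_point_def path x_def y_def\<close>)
    then show ?thesis
      using ups_T[of k s] p s modelled_T by simp
  next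
    case True
    then have k: "0 < k" "k < int n"
      using inner p by simp_all
    note ex = ex_projections[OF s(1,2) k, folded x_def y_def]
    consider "x \<le> int n + 1" "0 \<le> y" | "int n + 2 \<le> x" "y \<le> 0" | "int n + 2 \<le> x" "0 \<le> y"
      using xy(2) s(1) by linarith
    then show ?thesis
    proof cases
      case 1
      then obtain i j where "hF x y i" "vF x y j"
        using ex(1,2) by blast
      then have "same_word n Q indet (x, y) (portion (b, L) i j)"
        using same_word.on_F[of n Q indet x y i j] 1 True by (simp add: boundary proj bdry)
      then show ?thesis
        using T_value.same same_value by metis
    next
      case 2
      then obtain i j where "vT x y i" "hT x y j"
        using ex(3,4) by blast
      then have "same_word n Q indet (x, y) (swap_letters (portion (tb, tL) i j))"
        using same_word.on_tF[of n Q indet x y i j] 2 True by (simp add: boundary proj bdry)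
      then show ?thesis
        using T_value.same same_value by metis
    next
      case 3
      then obtain i j where "hF x y i" "vT x y j"
        using ex(1,4) by blast
      then have "mixed_word n Q indet (x, y) (portion (b, L) i (2 * n - j))"
        using mixed_word.intros[of n Q indet x y i j] 3 True by (simp add: boundary proj bdry)
      then show ?thesis
        using T_value.mixed mixed_value by metis
    qed
  qed
  moreover have "z = modelled_value a p" if "T_value n Q indet ups (x, y) z" for z
    using that
  proof cases
    case (boundary j l)
    \<comment> \<open>The sum of the coordinates of a point of \<open>Upsilon\<close> is its
      position in the quiver, so the point determines the position and then the level.\<close>
    then have "j = s"
      using coordinate_sum(1)[of j] xy(2) by (simp add: Upsilon_point_def path)
    moreover from this have "l = k"
      using boundary(4) by (simp add: Upsilon_point_def path x_def)
    ultimately show ?thesis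
      using boundary(1) ups_T[of k s] p s modelled_T by simp
  next
    case (same w)
    then show ?thesis
      using same_value by simp
  next
    case (mixed w)
    then show ?thesis
      using mixed_value by simp
  qed
  ultimately show ?thesis
    unfolding point using same_value mixed_value by blast
qed

end
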